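(* Let $(\widetilde M,\widetilde g,\widetilde P)$ be an almost product Riemannian manifold, $(\overline M,\overline g)$ a submanifold of codimension 1 isometrically immersed in $\widetilde M$ with unit normal $N_2$, and $(M,g)$ a submanifold of codimension 1 isometrically immersed in $\overline M$ with unit normal $N_1$ (in $\overline M$). Let $\overline P,u_2,\xi_2,a_{22}$ be induced on $\overline M$ from $\widetilde P$, let $P,u_1,\xi_1,a_{11}$ be induced on $M$ from $\overline P$, let $\xi_2^\top,\xi_2^\bot$ be the components of $\xi_2$ tangent, respectively normal, to $M$ in $\overline M$, and put $a_{12}=a_{21}=\widetilde g(\xi_2^\bot,N_1)$. Then the decompositions of $\widetilde PX$ ($X\in\chi(M)$), $\widetilde PN_1$ and $\widetilde PN_2$ into parts tangent and normal to $M$ in $\widetilde M$ are, along $M$: (i) $\widetilde PX=PX+u_1(X)N_1+u_2(X)N_2$ for all $X\in\chi(M)$; (ii) $\widetilde PN_1=\xi_1+a_{11}N_1+a_{12}N_2$; (iii) $\widetilde PN_2=\xi_2^\top+a_{12}N_1+a_{22}N_2$.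
   Context: An almost product Riemannian manifold $(\widetilde M,\widetilde g,\widetilde P)$ is a Riemannian manifold with a $(1,1)$-tensor field $\widetilde P$ such that $\widetilde P^2=I$ and $\widetilde g(\widetilde PU,\widetilde PV)=\widetilde g(U,V)$ for all vector fields $U,V$. The objects on $\overline M$ are defined by the decompositions into components tangent and normal to $\overline M$ in $\widetilde M$: $$\widetilde P\,\overline X=\overline P\,\overline X+u_2(\overline X)N_2\ (\overline X\in\chi(\overline M)),\qquad \widetilde PN_2=\xi_2+a_{22}N_2,$$ with $\overline P$ a $(1,1)$-tensor field, $u_2$ a 1-form, $\xi_2$ a vector field and $a_{22}$ a function on $\overline M$. The objects on $M$ are defined by the decompositions into components tangent and normal to $M$ in $\overline M$: $$\overline PX=PX+u_1(X)N_1\ (X\in\chi(M)),\qquad \overline PN_1=\xi_1+a_{11}N_1,$$ with $P$ a $(1,1)$-tensor field, $u_1$ a 1-form, $\xi_1$ a tangent vector field and $a_{11}$ a function on $M$. *)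

theory Defs
  imports "HOL-Analysis.Analysis" "HOL-Library.Function_Algebras"
begin

section \<open>Pointwise real vector space structure on functions\<close>

instantiation "fun" :: (type, real_vector) real_vector
begin

definition scaleR_fun :: "real \<Rightarrow> ('a \<Rightarrow> 'b) \<Rightarrow> 'a \<Rightarrow> 'b"
  where "c *\<^sub>R f = (\<lambda>x. c *\<^sub>R f x)"

instance
  by standard (simp_all add: scaleR_fun_def fun_eq_iff scaleR_add_right scaleR_add_left)

end


section \<open>Smooth functions on open subsets of Euclidean space\<close>

text \<open>
  The model space of dimension \<open>n\<close> is the library's \<^const>\<open>Euclidean_space\<close> \<open>n\<close>, whose points are
  the sequences \<open>x :: nat \<Rightarrow> real\<close> with \<open>x i = 0\<close> for \<open>i \<ge> n\<close>. In this way the dimension is an ordinary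
  natural number (0 included), and codimension 1 can be stated as an equation between dimensions.
\<close>

definition partial_deriv :: "nat \<Rightarrow> ((nat \<Rightarrow> real) \<Rightarrow> real) \<Rightarrow> (nat \<Rightarrow> real) \<Rightarrow> real"
  where "partial_deriv i f x = deriv (\<lambda>t. f (x(i := t))) (x i)"

text \<open>
  \<open>Ck_on k n V f\<close>: all partial derivatives of \<open>f\<close> of order at most \<open>k\<close> exist and are continuous on \<open>V\<close>.
  It is meant for \<open>V\<close> open in \<^const>\<open>Euclidean_space\<close> \<open>n\<close>; the subspace topology that such a \<open>V\<close>
  inherits from the product topology on \<open>nat \<Rightarrow> real\<close> is the usual one.
\<close>

primrec Ck_on :: "nat \<Rightarrow> nat \<Rightarrow> (nat \<Rightarrow> real) set \<Rightarrow> ((nat \<Rightarrow> real) \<Rightarrow> real) \<Rightarrow> bool" where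
  "Ck_on 0 n V f \<longleftrightarrow> continuous_on V f"
| "Ck_on (Suc k) n V f \<longleftrightarrow> continuous_on V f \<and>
     (\<forall>i<n. (\<forall>x\<in>V. (\<lambda>t. f (x(i := t))) field_differentiable at (x i)) \<and>
            Ck_on k n V (partial_deriv i f))"

definition smooth_on :: "nat \<Rightarrow> (nat \<Rightarrow> real) set \<Rightarrow> ((nat \<Rightarrow> real) \<Rightarrow> real) \<Rightarrow> bool"
  where "smooth_on n V f \<longleftrightarrow> (\<forall>k. Ck_on k n V f)"


section \<open>Smooth manifolds and smooth maps\<close>

text \<open>
  A chart is a pair \<open>(U, \<phi>)\<close> of its domain and its coordinate map; values of \<open>\<phi>\<close> outside \<open>U\<close> are
  irrelevant. An atlas need not be maximal.
\<close>

record 'p manifold =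
  mdim :: nat
  mtop :: "'p topology"
  atlas :: "('p set \<times> ('p \<Rightarrow> nat \<Rightarrow> real)) set"

abbreviation points :: "'p manifold \<Rightarrow> 'p set"
  where "points M \<equiv> topspace (mtop M)"

definition smooth_manifold :: "'p manifold \<Rightarrow> bool" where
  "smooth_manifold M \<longleftrightarrow>
     Hausdorff_space (mtop M) \<and> second_countable (mtop M) \<and>
     (\<Union>(U, \<phi>)\<in>atlas M. U) = points M \<and>
     (\<forall>(U, \<phi>)\<in>atlas M.
        openin (mtop M) U \<and> openin (Euclidean_space (mdim M)) (\<phi> ` U) \<and>
        homeomorphic_map (subtopology (mtop M) U)
          (subtopology (Euclidean_space (mdim M)) (\<phi> ` U)) \<phi>) \<and>
     (\<forall>(U, \<phi>)\<in>atlas M. \<forall>(V, \<psi>)\<in>atlas M. \<forall>i<mdim M.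
        smooth_on (mdim M) (\<phi> ` (U \<inter> V)) (\<lambda>x. \<psi> (inv_into U \<phi> x) i))"

definition smooth_fun_on :: "'p manifold \<Rightarrow> 'p set \<Rightarrow> ('p \<Rightarrow> real) \<Rightarrow> bool" where
  "smooth_fun_on M W h \<longleftrightarrow> openin (mtop M) W \<and>
     (\<forall>(U, \<phi>)\<in>atlas M. smooth_on (mdim M) (\<phi> ` (U \<inter> W)) (\<lambda>x. h (inv_into U \<phi> x)))"

abbreviation smooth_fun :: "'p manifold \<Rightarrow> ('p \<Rightarrow> real) \<Rightarrow> bool"
  where "smooth_fun M \<equiv> smooth_fun_on M (points M)"

definition smooth_near :: "'p manifold \<Rightarrow> 'p \<Rightarrow> ('p \<Rightarrow> real) \<Rightarrow> bool"
  where "smooth_near M p h \<longleftrightarrow> (\<exists>W. p \<in> W \<and> smooth_fun_on M W h)"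

definition smooth_map :: "'p manifold \<Rightarrow> 'q manifold \<Rightarrow> ('p \<Rightarrow> 'q) \<Rightarrow> bool" where
  "smooth_map M N f \<longleftrightarrow>
     continuous_map (mtop M) (mtop N) f \<and>
     (\<forall>(U, \<phi>)\<in>atlas M. \<forall>(V, \<psi>)\<in>atlas N. \<forall>i<mdim N.
        smooth_on (mdim M) (\<phi> ` (U \<inter> f -` V)) (\<lambda>x. \<psi> (f (inv_into U \<phi> x)) i))"


section \<open>Tangent vectors and the differential\<close>

text \<open>
  Tangent vectors at \<open>p\<close> are the derivations of the algebra of germs at \<open>p\<close> of smooth functions. Germs
  are represented by functions that are smooth near \<open>p\<close>. On all other functions a tangent vector
  is 0 by convention, so that tangent vectors are equal iff they agree on germs. The vector
  space operations are the pointwise ones.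
\<close>

type_synonym 'p tvec = "('p \<Rightarrow> real) \<Rightarrow> real"

definition tangent_space :: "'p manifold \<Rightarrow> 'p \<Rightarrow> 'p tvec set" where
  "tangent_space M p = {X.
     (\<forall>h k. smooth_near M p h \<longrightarrow> smooth_near M p k \<longrightarrow>
        X (h + k) = X h + X k \<and>
        X (h * k) = h p * X k + k p * X h \<and>
        ((\<exists>W. openin (mtop M) W \<and> p \<in> W \<and> (\<forall>q\<in>W. h q = k q)) \<longrightarrow> X h = X k)) \<and>
     (\<forall>c h. smooth_near M p h \<longrightarrow> X (c *\<^sub>R h) = c * X h) \<and>
     (\<forall>h. \<not> smooth_near M p h \<longrightarrow> X h = 0)}"

definition differential :: "'q manifold \<Rightarrow> ('p \<Rightarrow> 'q) \<Rightarrow> 'p \<Rightarrow> 'p tvec \<Rightarrow> 'q tvec" where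
  "differential N f p X = (\<lambda>h. if smooth_near N (f p) h then X (h \<circ> f) else 0)"

definition immersion :: "'p manifold \<Rightarrow> 'q manifold \<Rightarrow> ('p \<Rightarrow> 'q) \<Rightarrow> bool" where
  "immersion M N f \<longleftrightarrow> smooth_map M N f \<and>
     (\<forall>p\<in>points M. inj_on (differential N f p) (tangent_space M p))"


section \<open>Tensor fields\<close>

definition vector_field_along ::
    "'p manifold \<Rightarrow> 'q manifold \<Rightarrow> ('p \<Rightarrow> 'q) \<Rightarrow> ('p \<Rightarrow> 'q tvec) \<Rightarrow> bool" where
  "vector_field_along M N f V \<longleftrightarrow>
     (\<forall>p\<in>points M. V p \<in> tangent_space N (f p)) \<and>
     (\<forall>h. smooth_fun N h \<longrightarrow> smooth_fun M (\<lambda>p. V p h))"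

definition vector_fields :: "'p manifold \<Rightarrow> ('p \<Rightarrow> 'p tvec) set"
  where "vector_fields M = {X. vector_field_along M M id X}"

definition one_form :: "'p manifold \<Rightarrow> ('p \<Rightarrow> 'p tvec \<Rightarrow> real) \<Rightarrow> bool" where
  "one_form M u \<longleftrightarrow>
     (\<forall>p\<in>points M. \<forall>v\<in>tangent_space M p. \<forall>w\<in>tangent_space M p. \<forall>c.
        u p (v + w) = u p v + u p w \<and> u p (c *\<^sub>R v) = c * u p v) \<and>
     (\<forall>X\<in>vector_fields M. smooth_fun M (\<lambda>p. u p (X p)))"

text \<open>A (1,1)-tensor field is a smooth field of linear endomorphisms of the tangent spaces.\<close>

definition tensor_field_11 :: "'p manifold \<Rightarrow> ('p \<Rightarrow> 'p tvec \<Rightarrow> 'p tvec) \<Rightarrow> bool" where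
  "tensor_field_11 M A \<longleftrightarrow>
     (\<forall>p\<in>points M. \<forall>v\<in>tangent_space M p. \<forall>w\<in>tangent_space M p. \<forall>c.
        A p v \<in> tangent_space M p \<and>
        A p (v + w) = A p v + A p w \<and> A p (c *\<^sub>R v) = c *\<^sub>R A p v) \<and>
     (\<forall>X\<in>vector_fields M. (\<lambda>p. A p (X p)) \<in> vector_fields M)"

definition riemannian_metric :: "'p manifold \<Rightarrow> ('p \<Rightarrow> 'p tvec \<Rightarrow> 'p tvec \<Rightarrow> real) \<Rightarrow> bool" where
  "riemannian_metric M g \<longleftrightarrow>
     (\<forall>p\<in>points M. \<forall>v\<in>tangent_space M p.
        (\<forall>w\<in>tangent_space M p. \<forall>w'\<in>tangent_space M p. \<forall>c.
           g p v w = g p w v \<and>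
           g p v (w + w') = g p v w + g p v w' \<and>
           g p v (c *\<^sub>R w) = c * g p v w) \<and>
        (v \<noteq> 0 \<longrightarrow> g p v v > 0)) \<and>
     (\<forall>X\<in>vector_fields M. \<forall>Y\<in>vector_fields M. smooth_fun M (\<lambda>p. g p (X p) (Y p)))"

definition riemannian_manifold :: "'p manifold \<Rightarrow> ('p \<Rightarrow> 'p tvec \<Rightarrow> 'p tvec \<Rightarrow> real) \<Rightarrow> bool"
  where "riemannian_manifold M g \<longleftrightarrow> smooth_manifold M \<and> riemannian_metric M g"

definition almost_product_riemannian ::
    "'p manifold \<Rightarrow> ('p \<Rightarrow> 'p tvec \<Rightarrow> 'p tvec \<Rightarrow> real) \<Rightarrow> ('p \<Rightarrow> 'p tvec \<Rightarrow> 'p tvec) \<Rightarrow> bool" where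
  "almost_product_riemannian M g A \<longleftrightarrow>
     riemannian_manifold M g \<and> tensor_field_11 M A \<and>
     (\<forall>p\<in>points M. \<forall>v\<in>tangent_space M p. A p (A p v) = v) \<and>
     (\<forall>p\<in>points M. \<forall>v\<in>tangent_space M p. \<forall>w\<in>tangent_space M p. g p (A p v) (A p w) = g p v w)"


section \<open>Isometrically immersed submanifolds\<close>

definition isometric_immersion ::
    "'p manifold \<Rightarrow> ('p \<Rightarrow> 'p tvec \<Rightarrow> 'p tvec \<Rightarrow> real) \<Rightarrow>
     'q manifold \<Rightarrow> ('q \<Rightarrow> 'q tvec \<Rightarrow> 'q tvec \<Rightarrow> real) \<Rightarrow> ('p \<Rightarrow> 'q) \<Rightarrow> bool" where
  "isometric_immersion M g N g' f \<longleftrightarrow> immersion M N f \<and>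
     (\<forall>p\<in>points M. \<forall>v\<in>tangent_space M p. \<forall>w\<in>tangent_space M p.
        g' (f p) (differential N f p v) (differential N f p w) = g p v w)"

definition normal_space ::
    "'p manifold \<Rightarrow> 'q manifold \<Rightarrow> ('q \<Rightarrow> 'q tvec \<Rightarrow> 'q tvec \<Rightarrow> real) \<Rightarrow> ('p \<Rightarrow> 'q) \<Rightarrow> 'p \<Rightarrow> 'q tvec set"
  where
  "normal_space M N g' f p = {n \<in> tangent_space N (f p).
     \<forall>v\<in>tangent_space M p. g' (f p) n (differential N f p v) = 0}"

text \<open>
  \<open>t\<close> and \<open>n\<close> are the components of \<open>w \<in> T\<^bsub>f p\<^esub>N\<close> tangent and normal to \<open>M\<close> in \<open>N\<close>; the
  tangent component is regarded as a vector of \<open>T\<^bsub>p\<^esub>M\<close>.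
\<close>

definition tangent_normal_parts ::
    "'p manifold \<Rightarrow> 'q manifold \<Rightarrow> ('q \<Rightarrow> 'q tvec \<Rightarrow> 'q tvec \<Rightarrow> real) \<Rightarrow> ('p \<Rightarrow> 'q) \<Rightarrow> 'p \<Rightarrow>
     'q tvec \<Rightarrow> 'p tvec \<Rightarrow> 'q tvec \<Rightarrow> bool" where
  "tangent_normal_parts M N g' f p w t n \<longleftrightarrow>
     t \<in> tangent_space M p \<and> n \<in> normal_space M N g' f p \<and> w = differential N f p t + n"

definition unit_normal ::
    "'p manifold \<Rightarrow> 'q manifold \<Rightarrow> ('q \<Rightarrow> 'q tvec \<Rightarrow> 'q tvec \<Rightarrow> real) \<Rightarrow> ('p \<Rightarrow> 'q) \<Rightarrow> ('p \<Rightarrow> 'q tvec) \<Rightarrow> bool"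
  where
  "unit_normal M N g' f \<nu> \<longleftrightarrow> vector_field_along M N f \<nu> \<and>
     (\<forall>p\<in>points M. \<nu> p \<in> normal_space M N g' f p \<and> g' (f p) (\<nu> p) (\<nu> p) = 1)"

text \<open>
  \<open>(B, u, \<xi>, a)\<close> is the structure induced on the hypersurface \<open>M\<close> of \<open>N\<close> with unit normal \<open>\<nu>\<close> by the
  (1,1)-tensor field \<open>A\<close> of \<open>N\<close>: along \<open>M\<close>, \<open>A X = B X + u(X) \<nu>\<close> for \<open>X\<close> tangent to \<open>M\<close>, and \<open>A \<nu> = \<xi> + a \<nu>\<close>.
\<close>

definition induced_structure ::
    "'p manifold \<Rightarrow> 'q manifold \<Rightarrow> ('q \<Rightarrow> 'q tvec \<Rightarrow> 'q tvec \<Rightarrow> real) \<Rightarrow> ('p \<Rightarrow> 'q) \<Rightarrow> ('p \<Rightarrow> 'q tvec) \<Rightarrow>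
     ('q \<Rightarrow> 'q tvec \<Rightarrow> 'q tvec) \<Rightarrow>
     ('p \<Rightarrow> 'p tvec \<Rightarrow> 'p tvec) \<Rightarrow> ('p \<Rightarrow> 'p tvec \<Rightarrow> real) \<Rightarrow> ('p \<Rightarrow> 'p tvec) \<Rightarrow> ('p \<Rightarrow> real) \<Rightarrow> bool"
  where
  "induced_structure M N g' f \<nu> A B u \<xi> a \<longleftrightarrow>
     tensor_field_11 M B \<and> one_form M u \<and> \<xi> \<in> vector_fields M \<and> smooth_fun M a \<and>
     (\<forall>p\<in>points M.
        (\<forall>v\<in>tangent_space M p.
           tangent_normal_parts M N g' f p (A (f p) (differential N f p v)) (B p v) (u p v *\<^sub>R \<nu> p)) \<and>
        tangent_normal_parts M N g' f p (A (f p) (\<nu> p)) (\<xi> p) (a p *\<^sub>R \<nu> p))"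

end

theory Submission
  imports Defs
begin

text \<open>
  Decompose first along \<open>Mb\<close> in \<open>Mt\<close>, then decompose the part tangent to \<open>Mb\<close> along \<open>M\<close>. This gives (i)
  at once, and (ii) up to \<open>u2(N1) = a12\<close>, which holds because \<open>Pt\<close> is a symmetric operator (an isometric
  involution): \<open>u2(N1) = gt(Pt N1, N2) = gt(N1, Pt N2) = gb(N1, \<xi>2)\<close>. For (iii) one needs
  \<open>\<xi>2\<^sup>\<bottom> = a12 N1\<close>, that is, that the normal spaces of a hypersurface are lines. With tangent vectors
  defined as derivations of germs, this rests on \<open>dim T\<^sub>pM = mdim M\<close>, which follows from
  Hadamard's lemma and the chain rule.
\<close>

section \<open>Calculus on open subsets of Euclidean space\<close>

text \<open>The product topology on \<open>nat \<Rightarrow> real\<close> is not normable, so there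
  is no total derivative on the ambient type. All differentiation is along the lines
  \<open>\<lambda>t. f (x(i := t))\<close>, and the chain rule and Hadamard's lemma come from
  one-variable calculus and the continuity of partial derivatives.

  The dimension count depends on smoothness of infinite order. To apply the product rule to
  \<open>(x_l - a_l) * g_l\<close>, the Hadamard coefficient \<open>g_l\<close> must itself be a
  germ in the algebra on which derivations act. Its formula costs one derivative of
  \<open>f\<close>, so with a finite class the coefficient could leave the algebra; hence the radial
  integrals are controlled at every order.

  Both halves of the count are used. The coordinate derivations of the smaller manifold supply
  enough independent vectors, and Hadamard's lemma bounds the tangent space of the larger one from
  above.\<close>

definition coord_box :: "nat \<Rightarrow> (nat \<Rightarrow> real) \<Rightarrow> real \<Rightarrow> (nat \<Rightarrow> real) set"
  where "coord_box n a r = {x. (\<forall>l\<ge>n. x l = 0) \<and> (\<forall>l<n. \<bar>x l - a l\<bar> < r)}"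

lemma openin_Euclidean_space_iff:
  "openin (Euclidean_space n) V \<longleftrightarrow> (\<exists>T. open T \<and> V = T \<inter> {x. \<forall>i\<ge>n. x i = 0})"
  by (auto simp: Euclidean_space_def openin_subtopology euclidean_product_topology)

lemma Euclidean_spaceD:
  assumes "openin (Euclidean_space n) V" "x \<in> V" "n \<le> l"
  shows "x l = 0"
  using assms by (auto simp: openin_Euclidean_space_iff)

lemma openin_coord_box: "openin (Euclidean_space n) (coord_box n a r)"
proof -
  have "open (\<Inter>l<n. {x::nat \<Rightarrow> real. \<bar>x l - a l\<bar> < r})"
    by (intro open_INT ballI finite_lessThan open_Collect_less continuous_intros
          continuous_on_product_coordinates)
  then show ?thesis
    unfolding openin_Euclidean_space_iff coord_box_def
    by (intro exI[of _ "\<Inter>l<n. {x. \<bar>x l - a l\<bar> < r}"]) auto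
qed

text \<open>Cubes serve as neighbourhoods because they are stable under two moves: changing single
  coordinates within the side length, as in the chain rule, and shrinking towards the centre, as in
  the radial integrals.\<close>

lemma coord_box_exists:
  assumes "openin (Euclidean_space n) V" "x \<in> V"
  shows "\<exists>r>0. coord_box n x r \<subseteq> V"
proof -
  obtain T where T: "open T" "V = T \<inter> {x. \<forall>i\<ge>n. x i = 0}"
    using assms(1) by (auto simp: openin_Euclidean_space_iff)
  then have "openin (powertop_real UNIV) T" "x \<in> T"
    using assms(2) by (auto simp: euclidean_product_topology)
  then obtain X where X: "x \<in> Pi\<^sub>E UNIV X" "\<And>i. open (X i)" "finite {i. X i \<noteq> UNIV}" "Pi\<^sub>E UNIV X \<subseteq> T"
    using product_topology_open_contains_basis[of "\<lambda>_. euclideanreal" UNIV T x] by auto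
  have "\<forall>i. \<exists>e>0. ball (x i) e \<subseteq> X i"
    using X(1,2) by (auto simp: PiE_iff open_contains_ball)
  then obtain e where e: "\<And>i. e i > 0" "\<And>i. ball (x i) (e i) \<subseteq> X i"
    by metis
  \<comment> \<open>A basic open set of the product topology restricts finitely many coordinates, so
    the minimum exists; the \<open>1\<close> covers the case that it restricts none.\<close>
  define r where "r = Min (insert 1 (e ` {i. X i \<noteq> UNIV}))"
  have r: "r > 0" "\<And>i. X i \<noteq> UNIV \<Longrightarrow> r \<le> e i"
    using X(3) e(1) by (auto simp: r_def)
  have "y \<in> X i" if "y \<in> ball (x i) r" for i y
    using e(2)[of i] r(2)[of i] that by (cases "X i = UNIV") (simp, force)
  moreover have "y i \<in> ball (x i) r" if "y \<in> coord_box n x r" for i y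
    using that r(1) Euclidean_spaceD[OF assms, of i]
    by (cases "i < n") (auto simp: coord_box_def dist_real_def abs_minus_commute)
  ultimately have "coord_box n x r \<subseteq> V"
    using X(4) by (auto simp: T(2) PiE_iff coord_box_def subset_iff)
  with r(1) show ?thesis by blast
qed

text \<open>Partial derivatives are two-sided in \<open>t\<close>, although \<open>V\<close> is open
  only in the model space: for \<open>i < n\<close> the line in direction \<open>i\<close> stays in
  the model space, hence in \<open>V\<close> near \<open>x i\<close>. So values of a function off
  \<open>V\<close> do not affect its partial derivatives on \<open>V\<close>.\<close>

lemma eventually_fun_upd_mem:
  assumes "openin (Euclidean_space n) V" "x \<in> V" "i < n"
  shows "\<forall>\<^sub>F t in nhds (x i). x(i := t) \<in> V"
proof -
  obtain r where r: "r > 0" "coord_box n x r \<subseteq> V"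
    using coord_box_exists assms by blast
  have "x(i := t) \<in> coord_box n x r" if "dist t (x i) < r" for t
    using that r(1) assms Euclidean_spaceD[OF assms(1,2)] by (auto simp: coord_box_def dist_real_def)
  then show ?thesis
    using r by (auto simp: eventually_nhds_metric intro!: exI[of _ r])
qed

section \<open>Partial derivatives and functions of class C^k\<close>

lemma has_partial_deriv:
  assumes "Ck_on (Suc k) n V f" "x \<in> V" "i < n"
  shows "((\<lambda>t. f (x(i := t))) has_field_derivative partial_deriv i f x) (at (x i))"
  using assms by (simp add: partial_deriv_def DERIV_deriv_iff_field_differentiable)

lemma partial_derivI:
  "((\<lambda>t. f (x(i := t))) has_field_derivative d) (at (x i)) \<Longrightarrow> partial_deriv i f x = d"
  by (simp add: partial_deriv_def DERIV_imp_deriv)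

lemma Ck_on_SucI:
  assumes "continuous_on V f"
    and "\<And>i x. i < n \<Longrightarrow> x \<in> V \<Longrightarrow>
      ((\<lambda>t. f (x(i := t))) has_field_derivative partial_deriv i f x) (at (x i))"
    and "\<And>i. i < n \<Longrightarrow> Ck_on k n V (partial_deriv i f)"
  shows "Ck_on (Suc k) n V f"
  using assms by (auto simp: field_differentiable_def)

lemma Ck_on_imp_continuous_on: "Ck_on k n V f \<Longrightarrow> continuous_on V f"
  by (cases k) auto

lemma Ck_on_subset: "Ck_on k n V f \<Longrightarrow> V' \<subseteq> V \<Longrightarrow> Ck_on k n V' f"
  by (induction k arbitrary: f) (auto intro: continuous_on_subset)

lemma Ck_on_Suc_imp: "Ck_on (Suc k) n V f \<Longrightarrow> Ck_on k n V f"
proof (induction k arbitrary: f)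
  case (Suc k)
  show ?case
  proof (rule Ck_on_SucI)
    show "Ck_on k n V (partial_deriv i f)" if "i < n" for i
      using Suc that by auto
    show "continuous_on V f"
      using Suc.prems by simp
  qed (rule has_partial_deriv[OF Suc.prems])
qed simp

lemma has_field_derivative_fun_upd_cong:
  assumes "openin (Euclidean_space n) V" "\<And>x. x \<in> V \<Longrightarrow> f x = g x" "x \<in> V" "i < n"
  shows "((\<lambda>t. f (x(i := t))) has_field_derivative d) (at (x i)) \<longleftrightarrow>
         ((\<lambda>t. g (x(i := t))) has_field_derivative d) (at (x i))"
  by (rule DERIV_cong_ev) (use eventually_fun_upd_mem[OF assms(1,3,4)] assms(2) in \<open>auto elim: eventually_mono\<close>)

text \<open>The partial derivatives of \<open>f\<close> and \<open>g\<close> are again known to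
  agree on \<open>V\<close> only, so the induction runs over both functions at once.\<close>

lemma Ck_on_cong:
  assumes V: "openin (Euclidean_space n) V" and "\<And>x. x \<in> V \<Longrightarrow> f x = g x" "Ck_on k n V f"
  shows "Ck_on k n V g"
  using assms(2,3)
proof (induction k arbitrary: f g)
  case 0
  then show ?case using continuous_on_cong by force
next
  case (Suc k)
  have *: "((\<lambda>t. g (x(i := t))) has_field_derivative partial_deriv i f x) (at (x i))" if "i < n" "x \<in> V" for i x
    using has_field_derivative_fun_upd_cong[OF V _ that(2,1), of f g] Suc.prems(1) has_partial_deriv[OF Suc.prems(2) that(2,1)]
    by blast
  have eq: "partial_deriv i f x = partial_deriv i g x" if "i < n" "x \<in> V" for i x
    using partial_derivI[OF *[OF that]] by simp
  show ?case
  proof (rule Ck_on_SucI)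
    show "continuous_on V g"
      using Suc.prems continuous_on_cong[of V V f g] Ck_on_imp_continuous_on by blast
    show "Ck_on k n V (partial_deriv i g)" if "i < n" for i
    proof (rule Suc.IH)
      show "Ck_on k n V (partial_deriv i f)"
        using Suc.prems(2) that by simp
    qed (rule eq[OF that])
    show "((\<lambda>t. g (x(i := t))) has_field_derivative partial_deriv i g x) (at (x i))"
      if "i < n" "x \<in> V" for i x
      using *[OF that] eq[OF that] by simp
  qed
qed

text \<open>Off \<open>V\<close>, \<open>partial_deriv\<close> is an uncontrolled
  \<open>deriv\<close>, so a derivative formula can be expected to match it on \<open>V\<close>
  only. With this rule most closure properties below reduce to giving such a formula
  \<open>f'\<close> that is of class C^k.\<close>

lemma Ck_on_SucI':
  assumes V: "openin (Euclidean_space n) V" and "continuous_on V f"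
    and d: "\<And>i x. i < n \<Longrightarrow> x \<in> V \<Longrightarrow> ((\<lambda>t. f (x(i := t))) has_field_derivative f' i x) (at (x i))"
    and "\<And>i. i < n \<Longrightarrow> Ck_on k n V (f' i)"
  shows "Ck_on (Suc k) n V f"
proof (rule Ck_on_SucI)
  have eq: "f' i x = partial_deriv i f x" if "i < n" "x \<in> V" for i x
    using partial_derivI[OF d[OF that]] by simp
  show "Ck_on k n V (partial_deriv i f)" if "i < n" for i
    by (rule Ck_on_cong[OF V eq[OF that] assms(4)[OF that]])
  show "((\<lambda>t. f (x(i := t))) has_field_derivative partial_deriv i f x) (at (x i))"
    if "i < n" "x \<in> V" for i x
    using d[OF that] eq[OF that] by simp
qed fact

lemma Ck_on_const:
  assumes "openin (Euclidean_space n) V"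
  shows "Ck_on k n V (\<lambda>x. c)"
proof (induction k arbitrary: c)
  case (Suc k)
  show ?case
    by (rule Ck_on_SucI'[OF assms, where f' = "\<lambda>_ _. 0"]) (use Suc in auto)
qed simp

lemma Ck_on_coordinate:
  assumes "openin (Euclidean_space n) V"
  shows "Ck_on k n V (\<lambda>x. x l)"
proof (cases k)
  case 0
  then show ?thesis by (auto intro: continuous_on_subset[OF continuous_on_product_coordinates])
next
  case (Suc k')
  show ?thesis unfolding Suc
    by (rule Ck_on_SucI'[OF assms, where f' = "\<lambda>i _. if i = l then 1 else 0"])
      (auto intro!: continuous_on_subset[OF continuous_on_product_coordinates] Ck_on_const[OF assms] derivative_eq_intros)
qed

lemma Ck_on_add:
  assumes V: "openin (Euclidean_space n) V"
  shows "Ck_on k n V f \<Longrightarrow> Ck_on k n V g \<Longrightarrow> Ck_on k n V (\<lambda>x. f x + g x)"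
proof (induction k arbitrary: f g)
  case 0
  then show ?case by (auto intro!: continuous_intros)
next
  case (Suc k)
  show ?case
    by (rule Ck_on_SucI'[OF V, where f' = "\<lambda>i x. partial_deriv i f x + partial_deriv i g x"])
      (use Suc in \<open>auto intro!: continuous_intros DERIV_add has_partial_deriv Suc.IH simp del: fun_upd_apply\<close>)
qed

lemma Ck_on_mult:
  assumes V: "openin (Euclidean_space n) V"
  shows "Ck_on k n V f \<Longrightarrow> Ck_on k n V g \<Longrightarrow> Ck_on k n V (\<lambda>x. f x * g x)"
proof (induction k arbitrary: f g)
  case 0
  then show ?case by (auto intro!: continuous_intros)
next
  case (Suc k)
  have "((\<lambda>t. f (x(i := t)) * g (x(i := t))) has_field_derivative
          partial_deriv i f x * g x + f x * partial_deriv i g x) (at (x i))" if "i < n" "x \<in> V" for i x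
    using DERIV_mult[OF has_partial_deriv[OF Suc.prems(1) that(2,1)] has_partial_deriv[OF Suc.prems(2) that(2,1)]]
    by (simp add: algebra_simps del: fun_upd_apply)
  then show ?case
    by (intro Ck_on_SucI'[OF V, where f' = "\<lambda>i x. partial_deriv i f x * g x + f x * partial_deriv i g x"] Ck_on_add[OF V] Suc.IH)
      (use Suc.prems Suc.prems[THEN Ck_on_Suc_imp] in \<open>auto intro!: continuous_intros simp del: fun_upd_apply\<close>)
qed

lemma Ck_on_sum:
  assumes V: "openin (Euclidean_space n) V" and "\<And>l. l \<in> L \<Longrightarrow> Ck_on k n V (f l)"
  shows "Ck_on k n V (\<lambda>x. \<Sum>l\<in>L. f l x)"
  using assms(2)
  by (induction L rule: infinite_finite_induct) (auto intro!: Ck_on_const Ck_on_add V)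

text \<open>\<open>closed_segment\<close> covers both orders of the end points and the case that
  they coincide; in the chain rule the sign of a coordinate's increment is unknown.\<close>

lemma partial_deriv_mean_value:
  assumes f: "Ck_on (Suc 0) n V f" and i: "i < n"
    and seg: "\<And>t. t \<in> closed_segment a b \<Longrightarrow> y(i := t) \<in> V"
  shows "\<exists>t\<in>closed_segment a b. f (y(i := b)) - f (y(i := a)) = partial_deriv i f (y(i := t)) * (b - a)"
proof -
  have d: "((\<lambda>t. f (y(i := t))) has_field_derivative partial_deriv i f (y(i := t))) (at t)"
    if "t \<in> closed_segment a b" for t
    using has_partial_deriv[OF f seg[OF that] i] by simp
  consider "a < b" | "a = b" | "b < a" by linarith
  then show ?thesis
  proof cases
    case 1
    then have "\<exists>z. a < z \<and> z < b \<and> f (y(i := b)) - f (y(i := a)) = (b - a) * partial_deriv i f (y(i := z))"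
      by (intro MVT2[where f = "\<lambda>t. f (y(i := t))"] d) (simp_all add: closed_segment_eq_real_ivl)
    then obtain z where "a < z" "z < b" "f (y(i := b)) - f (y(i := a)) = (b - a) * partial_deriv i f (y(i := z))"
      by blast
    then show ?thesis
      by (intro bexI[of _ z]) (simp_all add: closed_segment_eq_real_ivl mult.commute del: fun_upd_apply)
  next
    case 3
    then have "\<exists>z. b < z \<and> z < a \<and> f (y(i := a)) - f (y(i := b)) = (a - b) * partial_deriv i f (y(i := z))"
      by (intro MVT2[where f = "\<lambda>t. f (y(i := t))"] d) (simp_all add: closed_segment_eq_real_ivl)
    then obtain z where "b < z" "z < a" "f (y(i := a)) - f (y(i := b)) = (a - b) * partial_deriv i f (y(i := z))"
      by blast
    then show ?thesis
      by (intro bexI[of _ z]) (simp_all add: closed_segment_eq_real_ivl algebra_simps del: fun_upd_apply)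
  qed auto
qed

lemma tendsto_coordinatewise:
  assumes "\<And>l. ((\<lambda>t. g t l) \<longlongrightarrow> (y l :: real)) F"
  shows "(g \<longlongrightarrow> y) F"
  using assms by (simp add: limitin_componentwise flip: limitin_canonical_iff euclidean_product_topology)

text \<open>The chain rule. The components of the curve are switched on one after another, and each step is
  controlled by the mean value theorem in one variable.\<close>

lemma has_field_derivative_compose_curve:
  fixes c :: "real \<Rightarrow> nat \<Rightarrow> real"
  assumes V: "openin (Euclidean_space n) V" and f: "Ck_on (Suc 0) n V f"
    and c0: "c t0 \<in> V" and cV: "\<forall>\<^sub>F t in at t0. c t \<in> V"
    and c': "\<And>l. l < n \<Longrightarrow> ((\<lambda>t. c t l) has_field_derivative c' l) (at t0)"
  shows "((\<lambda>t. f (c t)) has_field_derivative (\<Sum>l<n. partial_deriv l f (c t0) * c' l)) (at t0)"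
proof -
  obtain r where r: "r > 0" "coord_box n (c t0) r \<subseteq> V"
    using coord_box_exists[OF V c0] by blast
  define m where "m s t = (\<lambda>l. if l < s then c t l else c t0 l)" for s t
  have lim: "((\<lambda>t. c t l) \<longlongrightarrow> c t0 l) (at t0)" if "l < n" for l
    using DERIV_isCont[OF c'[OF that]] by (simp add: isCont_def)
  have near: "\<forall>\<^sub>F t in at t0. \<forall>l\<in>{..<n}. \<bar>c t l - c t0 l\<bar> < r"
    using lim r(1) by (intro eventually_ball_finite) (auto simp: tendsto_iff dist_real_def)
  have zero: "c t0 l = 0" if "l \<ge> n" for l
    using Euclidean_spaceD[OF V c0 that] .
  have step: "((\<lambda>t. f (m s t)) has_field_derivative (\<Sum>l<s. partial_deriv l f (c t0) * c' l)) (at t0)"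
    if "s \<le> n" for s
    using that
  proof (induction s)
    case 0
    then show ?case by (simp add: m_def)
  next
    case (Suc s)
    define y where "y t u = (m s t)(s := u)" for t u
    have yV: "y t u \<in> V" if "\<forall>l\<in>{..<n}. \<bar>c t l - c t0 l\<bar> < r" "u \<in> closed_segment (c t0 s) (c t s)" for t u
    proof -
      have "\<bar>u - c t0 s\<bar> \<le> \<bar>c t s - c t0 s\<bar>"
        using that(2) by (auto simp: closed_segment_eq_real_ivl split: if_splits)
      moreover have "\<bar>c t s - c t0 s\<bar> < r"
        using that(1) Suc.prems by auto
      ultimately have "\<bar>u - c t0 s\<bar> < r"
        by linarith
      then have "y t u \<in> coord_box n (c t0) r"
        using that(1) r(1) Suc.prems by (auto simp: y_def m_def coord_box_def zero)
      then show ?thesis using r(2) by blast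
    qed
    have y_eq: "y t (c t s) = m (Suc s) t" "y t (c t0 s) = m s t" for t
      by (auto simp: y_def m_def less_Suc_eq)
    have "\<exists>u\<in>closed_segment (c t0 s) (c t s).
        f (m (Suc s) t) - f (m s t) = partial_deriv s f (y t u) * (c t s - c t0 s)"
      if "\<forall>l\<in>{..<n}. \<bar>c t l - c t0 l\<bar> < r" for t
      using partial_deriv_mean_value[OF f, of s "c t0 s" "c t s" "m s t"] yV[OF that] Suc.prems
      unfolding y_eq[symmetric] by (auto simp: y_def)
    \<comment> \<open>Nothing is known about how \<open>\<theta>\<close> depends on
      \<open>t\<close>. The squeeze between \<open>c t0 s\<close> and \<open>c t s\<close> still
      gives its convergence, and continuity of \<open>partial_deriv s f\<close> at
      \<open>c t0\<close> asks for no more.\<close>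
    then obtain \<theta> where \<theta>: "\<And>t. \<forall>l\<in>{..<n}. \<bar>c t l - c t0 l\<bar> < r \<Longrightarrow> \<theta> t \<in> closed_segment (c t0 s) (c t s) \<and>
        f (m (Suc s) t) - f (m s t) = partial_deriv s f (y t (\<theta> t)) * (c t s - c t0 s)"
      by metis
    have "\<bar>\<theta> t - c t0 s\<bar> \<le> \<bar>c t s - c t0 s\<bar>" if "\<forall>l\<in>{..<n}. \<bar>c t l - c t0 l\<bar> < r" for t
      using \<theta>[OF that] by (auto simp: closed_segment_eq_real_ivl split: if_splits)
    then have "\<forall>\<^sub>F t in at t0. norm (\<theta> t - c t0 s) \<le> \<bar>c t s - c t0 s\<bar>"
      using near by (auto elim: eventually_mono)
    moreover have "((\<lambda>t. \<bar>c t s - c t0 s\<bar>) \<longlongrightarrow> 0) (at t0)"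
      using lim[of s] Suc.prems by (intro tendsto_rabs_zero LIM_zero) auto
    ultimately have "((\<lambda>t. \<theta> t - c t0 s) \<longlongrightarrow> 0) (at t0)"
      by (rule Lim_null_comparison)
    then have \<theta>_lim: "(\<theta> \<longlongrightarrow> c t0 s) (at t0)"
      by (rule LIM_zero_cancel)
    have y_lim: "((\<lambda>t. y t (\<theta> t)) \<longlongrightarrow> c t0) (at t0)"
    proof (rule tendsto_coordinatewise)
      fix l
      consider "l < s" | "l = s" | "s < l" by linarith
      then show "((\<lambda>t. y t (\<theta> t) l) \<longlongrightarrow> c t0 l) (at t0)"
        using lim[of l] \<theta>_lim Suc.prems by cases (auto simp: y_def m_def)
    qed
    have yV': "\<forall>\<^sub>F t in at t0. y t (\<theta> t) \<in> V"
      using near \<theta> yV by (auto elim!: eventually_mono)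
    have "continuous_on V (partial_deriv s f)"
      using f Suc.prems by auto
    then have D: "((\<lambda>t. partial_deriv s f (y t (\<theta> t))) \<longlongrightarrow> partial_deriv s f (c t0)) (at t0)"
      by (rule continuous_on_tendsto_compose[OF _ y_lim c0 yV'])
    have "((\<lambda>t. (c t s - c t0 s) / (t - t0)) \<longlongrightarrow> c' s) (at t0)"
      using c'[of s] Suc.prems by (simp add: has_field_derivative_iff)
    from tendsto_mult[OF D this]
    have "((\<lambda>t. partial_deriv s f (y t (\<theta> t)) * (c t s - c t0 s)) has_field_derivative
        partial_deriv s f (c t0) * c' s) (at t0)"
      by (simp add: has_field_derivative_iff)
    then have "((\<lambda>t. f (m s t) + partial_deriv s f (y t (\<theta> t)) * (c t s - c t0 s)) has_field_derivative
        (\<Sum>l<Suc s. partial_deriv l f (c t0) * c' l)) (at t0)"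
      using DERIV_add[OF Suc.IH] Suc.prems by simp
    moreover have "\<forall>\<^sub>F t in at t0. f (m s t) + partial_deriv s f (y t (\<theta> t)) * (c t s - c t0 s) = f (m (Suc s) t)"
      using near by (rule eventually_mono) (use \<theta> in force)
    moreover have "m s t0 = m (Suc s) t0"
      by (auto simp: m_def)
    ultimately show ?case
      by (subst (asm) has_field_derivative_cong_eventually) auto
  qed
  \<comment> \<open>From index \<open>n\<close> on, \<open>m n t\<close> has the entries of
    \<open>c t0\<close> instead of those of \<open>c t\<close>; both vanish, as both points lie in
    the model space.\<close>
  have eq: "m n t = c t" if "c t \<in> V" for t
    using Euclidean_spaceD[OF V that] by (auto simp: m_def zero)
  have "\<forall>\<^sub>F t in at t0. f (m n t) = f (c t)"
    using cV by (rule eventually_mono) (simp add: eq)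
  then show ?thesis
    using step[OF order_refl] by (subst (asm) has_field_derivative_cong_eventually) (auto simp: eq[OF c0])
qed

text \<open>By the chain rule, a partial derivative of \<open>f \<circ> g\<close> is a sum of
  products of \<open>partial_deriv l f \<circ> g\<close> with a partial derivative of a component of
  \<open>g\<close>. The induction hypothesis handles the first factor, with \<open>f\<close>
  varying, \<open>g\<close> fixed and one order less.\<close>

lemma Ck_on_compose:
  assumes W: "openin (Euclidean_space m) W" and V: "openin (Euclidean_space n) V"
    and gV: "\<And>x. x \<in> W \<Longrightarrow> g x \<in> V"
  shows "Ck_on k n V f \<Longrightarrow> (\<And>l. l < n \<Longrightarrow> Ck_on k m W (\<lambda>x. g x l)) \<Longrightarrow> Ck_on k m W (\<lambda>x. f (g x))"
proof (induction k arbitrary: f)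
  case 0
  \<comment> \<open>The hypothesis covers the components below \<open>n\<close>; the others vanish
    on \<open>W\<close> because \<open>V\<close> lies in the model space.\<close>
  have "continuous_on W (\<lambda>x. g x l)" for l
  proof (cases "l < n")
    case False
    then have "g x l = 0" if "x \<in> W" for x
      using Euclidean_spaceD[OF V gV[OF that]] by simp
    then show ?thesis by (subst continuous_on_cong[OF refl]) auto
  qed (use 0 in auto)
  then have "continuous_on W g"
    by (rule continuous_on_coordinatewise_then_product)
  then show ?case
    using 0 gV continuous_on_compose2[of V f W g] by auto
next
  case (Suc k)
  have f1: "Ck_on (Suc 0) n V f"
    using Suc.prems(1) by (auto intro: Ck_on_imp_continuous_on)
  show ?case
  proof (rule Ck_on_SucI'[OF W])
    show "continuous_on W (\<lambda>x. f (g x))"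
      using Suc.IH[OF Suc.prems(1)[THEN Ck_on_Suc_imp]] Suc.prems(2)[THEN Ck_on_Suc_imp]
      by (blast intro: Ck_on_imp_continuous_on)
    show "((\<lambda>t. f (g (x(i := t)))) has_field_derivative
        (\<Sum>l<n. partial_deriv l f (g x) * partial_deriv i (\<lambda>x. g x l) x)) (at (x i))"
      if i: "i < m" and x: "x \<in> W" for i x
    proof -
      have "\<forall>\<^sub>F t in at (x i). x(i := t) \<in> W"
        using eventually_fun_upd_mem[OF W x i] by (auto simp: eventually_at_filter elim: eventually_mono)
      then have "\<forall>\<^sub>F t in at (x i). g (x(i := t)) \<in> V"
        by (rule eventually_mono) (rule gV)
      then show ?thesis
        using has_field_derivative_compose_curve[OF V f1, of "\<lambda>t. g (x(i := t))" "x i"]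
          gV[OF x] has_partial_deriv[OF Suc.prems(2) x i] by (simp del: fun_upd_apply)
    qed
    show "Ck_on k m W (\<lambda>x. \<Sum>l<n. partial_deriv l f (g x) * partial_deriv i (\<lambda>x. g x l) x)"
      if i: "i < m" for i
    proof (rule Ck_on_sum[OF W])
      fix l assume "l \<in> {..<n}"
      then have l: "l < n" by simp
      have "Ck_on k m W (\<lambda>x. partial_deriv l f (g x))"
      proof (rule Suc.IH)
        show "Ck_on k n V (partial_deriv l f)"
          using Suc.prems(1) l by simp
      qed (rule Suc.prems(2)[THEN Ck_on_Suc_imp])
      moreover have "Ck_on k m W (partial_deriv i (\<lambda>x. g x l))"
        using Suc.prems(2)[OF l] i by simp
      ultimately show "Ck_on k m W (\<lambda>x. partial_deriv l f (g x) * partial_deriv i (\<lambda>x. g x l) x)"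
        by (rule Ck_on_mult[OF W])
    qed
  qed
qed

text \<open>Hadamard's lemma: near \<open>a\<close>, \<open>f x = f a + \<Sum>\<^sub>l (x\<^sub>l - a\<^sub>l) g\<^sub>l x\<close> with
  \<open>g\<^sub>l x = \<integral>\<^sub>0\<^sup>1 \<partial>\<^sub>l f (a + t (x - a)) dt\<close>. The factor \<open>t\<^sup>s\<close> makes the class of such
  integrals closed under partial derivatives.\<close>

definition radial_integral :: "nat \<Rightarrow> (nat \<Rightarrow> real) \<Rightarrow> ((nat \<Rightarrow> real) \<Rightarrow> real) \<Rightarrow> (nat \<Rightarrow> real) \<Rightarrow> real"
  where "radial_integral s a f x = integral {0..1} (\<lambda>t. t ^ s * f (\<lambda>l. a l + t * (x l - a l)))"

lemma segment_mem_coord_box: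
  assumes "\<And>l. n \<le> l \<Longrightarrow> a l = 0" "x \<in> coord_box n a r" "t \<in> {0..1}"
  shows "(\<lambda>l. a l + t * (x l - a l)) \<in> coord_box n a r"
proof -
  have "\<bar>t * (x l - a l)\<bar> < r" if "l < n" for l
  proof -
    have "\<bar>t * (x l - a l)\<bar> \<le> \<bar>x l - a l\<bar>"
      using assms(3) by (simp add: abs_mult mult_left_le_one_le)
    also have "\<dots> < r" using assms(2) that by (simp add: coord_box_def)
    finally show ?thesis .
  qed
  then show ?thesis using assms by (simp add: coord_box_def)
qed

text \<open>Joint continuity in \<open>(x, t)\<close> is what both continuity of the parameter
  integral and differentiation under it require.\<close>

lemma continuous_on_radial_integrand:
  assumes a: "\<And>l. n \<le> l \<Longrightarrow> a l = 0" and f: "continuous_on (coord_box n a r) f"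
  shows "continuous_on (coord_box n a r \<times> {0..1}) (\<lambda>(x, t). t ^ s * f (\<lambda>l. a l + t * (x l - a l)))"
proof -
  have "continuous_on (coord_box n a r \<times> {0..1}) (\<lambda>z. fst z l)" for l
    by (rule continuous_on_product_then_coordinatewise) (intro continuous_intros)
  then have "continuous_on (coord_box n a r \<times> {0..1}) (\<lambda>z l. a l + snd z * (fst z l - a l))"
    by (intro continuous_on_coordinatewise_then_product continuous_intros)
  then have "continuous_on (coord_box n a r \<times> {0..1}) (\<lambda>z. f (\<lambda>l. a l + snd z * (fst z l - a l)))"
    by (rule continuous_on_compose2[OF f]) (use segment_mem_coord_box[of n a, OF a] in auto)
  then show ?thesis
    unfolding case_prod_beta by (intro continuous_intros)
qed

text \<open>Differentiation under the integral sign. The inner derivative contributes a factor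
  \<open>t\<close> and turns \<open>s\<close> into \<open>Suc s\<close>, so \<open>s\<close> varies
  in the induction along with \<open>f\<close>.\<close>

lemma Ck_on_radial_integral:
  assumes a: "\<And>l. n \<le> l \<Longrightarrow> a l = 0"
  shows "Ck_on k n (coord_box n a r) f \<Longrightarrow> Ck_on k n (coord_box n a r) (radial_integral s a f)"
proof (induction k arbitrary: f s)
  case 0
  then show ?case
    using integral_continuous_on_param[where a = "0::real" and b = 1, folded box_real,
        OF continuous_on_radial_integrand[OF a, where f = f and s = s and r = r, folded box_real]]
    by (simp add: radial_integral_def[abs_def])
next
  case (Suc k)
  let ?B = "coord_box n a r" and ?y = "\<lambda>x t l. a l + t * (x l - a l)"
  note B = openin_coord_box[of n a r]
  have f1: "Ck_on (Suc 0) n ?B f"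
    using Suc.prems by (auto intro: Ck_on_imp_continuous_on)
  show ?case
  proof (rule Ck_on_SucI'[OF B])
    show "continuous_on ?B (radial_integral s a f)"
      using Suc.IH[OF Suc.prems[THEN Ck_on_Suc_imp]] by (blast intro: Ck_on_imp_continuous_on)
    show "Ck_on k n ?B (radial_integral (Suc s) a (partial_deriv i f))" if "i < n" for i
      using Suc that by simp
    show "((\<lambda>u. radial_integral s a f (x(i := u))) has_field_derivative
        radial_integral (Suc s) a (partial_deriv i f) x) (at (x i))" if i: "i < n" and x: "x \<in> ?B" for i x
    proof -
      \<comment> \<open>The admissible values of coordinate \<open>i\<close> form an interval
        centred at \<open>a i\<close>, not at \<open>x i\<close>. Being convex it fits Leibniz's
        rule, and being open it lets the derivative within \<open>U\<close> become a full
        derivative.\<close>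
      define U where "U = {u. x(i := u) \<in> ?B}"
      have U_eq: "U = ball (a i) r"
        using x i by (auto simp: U_def coord_box_def dist_real_def abs_minus_commute)
      have d: "((\<lambda>u. t ^ s * f (?y (x(i := u)) t)) has_field_derivative
          t ^ Suc s * partial_deriv i f (?y (x(i := u0)) t)) (at u0 within U)"
        if u0: "u0 \<in> U" and t: "t \<in> cbox 0 1" for u0 t
      proof -
        have "\<forall>\<^sub>F u in nhds u0. u \<in> U"
          using u0 unfolding U_eq by (intro eventually_nhds_in_open) auto
        then have "\<forall>\<^sub>F u in at u0. ?y (x(i := u)) t \<in> ?B"
          unfolding eventually_at_filter
          by (rule eventually_mono) (use t segment_mem_coord_box[of n a, OF a] in \<open>simp add: U_def del: fun_upd_apply\<close>)
        moreover have "?y (x(i := u0)) t \<in> ?B"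
          using u0 t by (intro segment_mem_coord_box[of n a, OF a]) (auto simp: U_def simp del: fun_upd_apply)
        \<comment> \<open>The path moves in coordinate \<open>i\<close> only, with speed
          \<open>t\<close>, so the chain rule sum collapses to one term.\<close>
        moreover have "((\<lambda>u. ?y (x(i := u)) t l) has_field_derivative (if l = i then t else 0)) (at u0)" for l
          by (auto intro!: derivative_eq_intros)
        ultimately have "((\<lambda>u. f (?y (x(i := u)) t)) has_field_derivative
            (\<Sum>l<n. partial_deriv l f (?y (x(i := u0)) t) * (if l = i then t else 0))) (at u0)"
          by (intro has_field_derivative_compose_curve[OF B f1])
        also have "(\<Sum>l<n. partial_deriv l f (?y (x(i := u0)) t) * (if l = i then t else 0)) =
            (\<Sum>l<n. if l = i then partial_deriv i f (?y (x(i := u0)) t) * t else 0)"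
          by (rule sum.cong) (simp_all del: fun_upd_apply)
        also have "\<dots> = partial_deriv i f (?y (x(i := u0)) t) * t"
          using i by (simp del: fun_upd_apply)
        finally have "((\<lambda>u. f (?y (x(i := u)) t)) has_field_derivative
            partial_deriv i f (?y (x(i := u0)) t) * t) (at u0)" .
        from has_field_derivative_at_within[OF DERIV_cmult[OF this, of "t ^ s"]] show ?thesis
          by (simp add: mult_ac del: fun_upd_apply)
      qed
      \<comment> \<open>Stated for arbitrary \<open>h\<close> and \<open>q\<close> for two uses: the
        integrand itself (integrability) and its derivative in \<open>u\<close> (continuity in
        Leibniz's rule).\<close>
      have cont: "continuous_on (U \<times> cbox 0 1) (\<lambda>(u, t). t ^ q * h (?y (x(i := u)) t))"
        if "continuous_on ?B h" for h q
      proof -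
        have "continuous_on (U \<times> {0..1}) (\<lambda>z. (x(i := fst z)) l)" for l
          by (cases "l = i") (auto intro!: continuous_intros)
        then have cont: "continuous_on (U \<times> {0..1}) (\<lambda>z. (x(i := fst z), snd z))"
          by (intro continuous_intros continuous_on_coordinatewise_then_product)
        have img: "(\<lambda>z. (x(i := fst z), snd z)) ` (U \<times> {0..1}) \<subseteq> ?B \<times> {0..1}"
          by (auto simp: U_def simp del: fun_upd_apply)
        show ?thesis
          using continuous_on_compose2[OF continuous_on_radial_integrand[of n a, OF a that] cont img, of q]
          by (simp add: case_prod_beta del: fun_upd_apply)
      qed
      have integrable: "(\<lambda>t. t ^ s * f (?y (x(i := u)) t)) integrable_on cbox 0 1" if "u \<in> U" for u
      proof (rule integrable_continuous)
        have "continuous_on (cbox 0 1) (\<lambda>t. (u, t))"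
          by (intro continuous_intros)
        from continuous_on_compose2[OF cont[OF Ck_on_imp_continuous_on[OF f1], of s] this]
        show "continuous_on (cbox 0 1) (\<lambda>t. t ^ s * f (?y (x(i := u)) t))"
          using that by (auto simp del: fun_upd_apply)
      qed
      have cont': "continuous_on (U \<times> cbox 0 1) (\<lambda>(u, t). t ^ Suc s * partial_deriv i f (?y (x(i := u)) t))"
        by (rule cont) (use f1 i in auto)
      have U: "x i \<in> U" "convex U" "open U"
        using x by (simp add: U_def) (simp_all add: U_eq)
      have "((\<lambda>u. integral (cbox 0 1) (\<lambda>t. t ^ s * f (?y (x(i := u)) t))) has_field_derivative
          integral (cbox 0 1) (\<lambda>t. t ^ Suc s * partial_deriv i f (?y (x(i := x i)) t))) (at (x i) within U)"
        by (rule leibniz_rule_field_derivative[where f = "\<lambda>u t. t ^ s * f (?y (x(i := u)) t)"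
              and fx = "\<lambda>u t. t ^ Suc s * partial_deriv i f (?y (x(i := u)) t)" and ?x0.0 = "x i"])
          (fact d integrable cont' U)+
      then show ?thesis
        unfolding radial_integral_def box_real at_within_open[OF U(1,3)] fun_upd_triv .
    qed
  qed
qed

lemma hadamard:
  assumes a: "\<And>l. n \<le> l \<Longrightarrow> a l = 0" and f: "Ck_on (Suc 0) n (coord_box n a r) f"
    and x: "x \<in> coord_box n a r"
  shows "f x = f a + (\<Sum>l<n. (x l - a l) * radial_integral 0 a (partial_deriv l f) x)"
proof -
  let ?B = "coord_box n a r" and ?y = "\<lambda>t l. a l + t * (x l - a l)"
  have cont: "continuous_on {0..1} (\<lambda>t. h (?y t))" if "continuous_on ?B h" for h
  proof (rule continuous_on_compose2[OF that])
    show "continuous_on {0..1} ?y"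
      by (intro continuous_on_coordinatewise_then_product continuous_intros)
  qed (use segment_mem_coord_box[of n a, OF a x] in auto)
  have integrable: "(\<lambda>t. (x l - a l) * partial_deriv l f (?y t)) integrable_on {0..1}" if "l < n" for l
    using f that by (intro integrable_continuous_interval continuous_intros cont) auto
  have d: "((\<lambda>t. f (?y t)) has_vector_derivative (\<Sum>l<n. (x l - a l) * partial_deriv l f (?y t))) (at t within {0..1})"
    if t: "t \<in> {0..1}" for t
  proof -
    have yB: "?y t \<in> ?B"
      using segment_mem_coord_box[of n a, OF a x t] .
    \<comment> \<open>The chain rule is two-sided, but at \<open>t = 0\<close> and
      \<open>t = 1\<close> some nearby \<open>u\<close> leave \<open>{0..1}\<close>; the strict
      inequalities that define the box persist for them.\<close>
    have "\<forall>\<^sub>F u in at t. ?y u \<in> ?B"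
    proof -
      have "\<forall>l\<in>{..<n}. \<forall>\<^sub>F u in at t. \<bar>?y u l - a l\<bar> < r"
      proof
        fix l assume "l \<in> {..<n}"
        then have "\<bar>?y t l - a l\<bar> < r" using yB by (auto simp: coord_box_def)
        moreover have "((\<lambda>u. \<bar>?y u l - a l\<bar>) \<longlongrightarrow> \<bar>?y t l - a l\<bar>) (at t)"
          by (intro tendsto_intros)
        ultimately show "\<forall>\<^sub>F u in at t. \<bar>?y u l - a l\<bar> < r"
          by (rule order_tendstoD(2)[rotated])
      qed
      then have "\<forall>\<^sub>F u in at t. \<forall>l\<in>{..<n}. \<bar>?y u l - a l\<bar> < r"
        by (rule eventually_ball_finite[OF finite_lessThan])
      then show ?thesis
        by (rule eventually_mono) (use a x in \<open>auto simp: coord_box_def\<close>)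
    qed
    moreover have "((\<lambda>u. ?y u l) has_field_derivative (x l - a l)) (at t)" for l
      by (auto intro!: derivative_eq_intros)
    ultimately have "((\<lambda>u. f (?y u)) has_field_derivative (\<Sum>l<n. partial_deriv l f (?y t) * (x l - a l))) (at t)"
      using has_field_derivative_compose_curve[OF openin_coord_box f, of ?y t "\<lambda>l. x l - a l"] yB by simp
    then show ?thesis
      by (simp add: has_real_derivative_iff_has_vector_derivative has_vector_derivative_at_within mult.commute)
  qed
  have "((\<lambda>t. \<Sum>l<n. (x l - a l) * partial_deriv l f (?y t)) has_integral f (?y 1) - f (?y 0)) {0..1}"
    by (rule fundamental_theorem_of_calculus[OF _ d]) auto
  then have "f x - f a = integral {0..1} (\<lambda>t. \<Sum>l<n. (x l - a l) * partial_deriv l f (?y t))"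
    by (simp add: integral_unique)
  also have "\<dots> = (\<Sum>l<n. (x l - a l) * radial_integral 0 a (partial_deriv l f) x)"
    using integrable by (subst integral_sum) (auto simp: radial_integral_def)
  finally show ?thesis by simp
qed

section \<open>Smooth functions\<close>

lemma smooth_on_cong:
  "openin (Euclidean_space n) V \<Longrightarrow> (\<And>x. x \<in> V \<Longrightarrow> f x = g x) \<Longrightarrow> smooth_on n V f \<Longrightarrow> smooth_on n V g"
  unfolding smooth_on_def by (blast intro: Ck_on_cong)

lemma smooth_on_subset: "smooth_on n V f \<Longrightarrow> V' \<subseteq> V \<Longrightarrow> smooth_on n V' f"
  unfolding smooth_on_def by (blast intro: Ck_on_subset)

lemma smooth_on_const: "openin (Euclidean_space n) V \<Longrightarrow> smooth_on n V (\<lambda>x. c)"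
  by (simp add: smooth_on_def Ck_on_const)

lemma smooth_on_coordinate: "openin (Euclidean_space n) V \<Longrightarrow> smooth_on n V (\<lambda>x. x l)"
  by (simp add: smooth_on_def Ck_on_coordinate)

lemma smooth_on_add:
  "openin (Euclidean_space n) V \<Longrightarrow> smooth_on n V f \<Longrightarrow> smooth_on n V g \<Longrightarrow> smooth_on n V (\<lambda>x. f x + g x)"
  by (simp add: smooth_on_def Ck_on_add)

lemma smooth_on_mult:
  "openin (Euclidean_space n) V \<Longrightarrow> smooth_on n V f \<Longrightarrow> smooth_on n V g \<Longrightarrow> smooth_on n V (\<lambda>x. f x * g x)"
  by (simp add: smooth_on_def Ck_on_mult)

lemma smooth_on_partial_deriv:
  assumes "smooth_on n V f" "i < n"
  shows "smooth_on n V (partial_deriv i f)"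
  unfolding smooth_on_def
proof
  fix k
  have "Ck_on (Suc k) n V f" using assms(1) unfolding smooth_on_def by blast
  then show "Ck_on k n V (partial_deriv i f)" using assms(2) by simp
qed

lemma smooth_on_radial_integral:
  assumes "\<And>l. n \<le> l \<Longrightarrow> a l = 0" "smooth_on n (coord_box n a r) f"
  shows "smooth_on n (coord_box n a r) (radial_integral s a f)"
  using assms(2) Ck_on_radial_integral[of n a, OF assms(1)] unfolding smooth_on_def by blast

lemma smooth_on_compose:
  assumes W: "openin (Euclidean_space m) W" and V: "openin (Euclidean_space n) V"
    and gV: "\<And>x. x \<in> W \<Longrightarrow> g x \<in> V"
    and f: "smooth_on n V f" and g: "\<And>l. l < n \<Longrightarrow> smooth_on m W (\<lambda>x. g x l)"
  shows "smooth_on m W (\<lambda>x. f (g x))"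
  unfolding smooth_on_def
proof
  fix k
  show "Ck_on k m W (\<lambda>x. f (g x))"
    by (rule Ck_on_compose[where g = g, OF W V gV]) (use f g in \<open>auto simp: smooth_on_def\<close>)
qed

lemma smooth_on_has_partial_deriv:
  assumes "smooth_on n V f" "x \<in> V" "i < n"
  shows "((\<lambda>t. f (x(i := t))) has_field_derivative partial_deriv i f x) (at (x i))"
proof -
  have "Ck_on (Suc 0) n V f" using assms(1) unfolding smooth_on_def by blast
  then show ?thesis using assms(2,3) by (rule has_partial_deriv)
qed

section \<open>Charts and functions smooth on open sets\<close>

lemma chart_exists:
  assumes "smooth_manifold M" "p \<in> points M"
  obtains U \<phi> where "(U, \<phi>) \<in> atlas M" "p \<in> U"
proof -
  have "p \<in> (\<Union>(U, \<phi>)\<in>atlas M. U)"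
    using assms unfolding smooth_manifold_def by blast
  then show ?thesis using that by auto
qed

lemma chart_openin: "smooth_manifold M \<Longrightarrow> (U, \<phi>) \<in> atlas M \<Longrightarrow> openin (mtop M) U"
  unfolding smooth_manifold_def by blast

lemma chart_homeomorphic_map:
  assumes "smooth_manifold M" "(U, \<phi>) \<in> atlas M"
  shows "homeomorphic_map (subtopology (mtop M) U) (subtopology (Euclidean_space (mdim M)) (\<phi> ` U)) \<phi>"
  using assms unfolding smooth_manifold_def by blast

lemma chart_inj_on:
  assumes "smooth_manifold M" "(U, \<phi>) \<in> atlas M"
  shows "inj_on \<phi> U"
proof -
  have "topspace (subtopology (mtop M) U) = U"
    using openin_subset[OF chart_openin[OF assms]] by auto
  then show ?thesis
    using homeomorphic_imp_injective_map[OF chart_homeomorphic_map[OF assms]] by simp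
qed

lemma chart_image_openin:
  assumes M: "smooth_manifold M" "(U, \<phi>) \<in> atlas M" and W: "openin (mtop M) W"
  shows "openin (Euclidean_space (mdim M)) (\<phi> ` (U \<inter> W))"
proof -
  have "openin (subtopology (mtop M) U) (U \<inter> W)"
    using W by (auto simp: openin_subtopology)
  then have "openin (subtopology (Euclidean_space (mdim M)) (\<phi> ` U)) (\<phi> ` (U \<inter> W))"
    using homeomorphic_imp_open_map[OF chart_homeomorphic_map[OF M]] by (simp add: open_map_def)
  moreover have "openin (Euclidean_space (mdim M)) (\<phi> ` U)"
    using M unfolding smooth_manifold_def by blast
  ultimately show ?thesis
    by (rule openin_trans_full)
qed

lemma chart_preimage_openin:
  assumes M: "smooth_manifold M" "(U, \<phi>) \<in> atlas M" and B: "openin (Euclidean_space (mdim M)) B"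
  shows "openin (mtop M) {q \<in> U. \<phi> q \<in> B}"
proof -
  have "openin (subtopology (Euclidean_space (mdim M)) (\<phi> ` U)) (B \<inter> \<phi> ` U)"
    using B by (auto simp: openin_subtopology)
  then have "openin (subtopology (mtop M) U) {q \<in> topspace (subtopology (mtop M) U). \<phi> q \<in> B \<inter> \<phi> ` U}"
    using homeomorphic_imp_continuous_map[OF chart_homeomorphic_map[OF M]] openin_continuous_map_preimage by blast
  moreover have "{q \<in> topspace (subtopology (mtop M) U). \<phi> q \<in> B \<inter> \<phi> ` U} = {q \<in> U. \<phi> q \<in> B}"
    using openin_subset[OF chart_openin[OF M]] by auto
  ultimately show ?thesis
    using openin_trans_full[OF _ chart_openin[OF M]] by simp
qed

lemma smooth_fun_on_imp_openin: "smooth_fun_on M W h \<Longrightarrow> openin (mtop M) W"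
  by (simp add: smooth_fun_on_def)

lemma smooth_fun_onD:
  "smooth_fun_on M W h \<Longrightarrow> (U, \<phi>) \<in> atlas M \<Longrightarrow>
    smooth_on (mdim M) (\<phi> ` (U \<inter> W)) (\<lambda>x. h (inv_into U \<phi> x))"
  unfolding smooth_fun_on_def by blast

lemma smooth_fun_onI:
  "openin (mtop M) W \<Longrightarrow>
    (\<And>U \<phi>. (U, \<phi>) \<in> atlas M \<Longrightarrow> smooth_on (mdim M) (\<phi> ` (U \<inter> W)) (\<lambda>x. h (inv_into U \<phi> x))) \<Longrightarrow>
    smooth_fun_on M W h"
  unfolding smooth_fun_on_def by blast

lemma smooth_fun_on_subset:
  assumes "smooth_fun_on M W h" "openin (mtop M) W'" "W' \<subseteq> W"
  shows "smooth_fun_on M W' h"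
  using assms(2,3) by (intro smooth_fun_onI smooth_on_subset[OF smooth_fun_onD[OF assms(1)]]) auto

lemma smooth_fun_on_const:
  assumes "smooth_manifold M" "openin (mtop M) W"
  shows "smooth_fun_on M W (\<lambda>q. c)"
  using assms by (intro smooth_fun_onI smooth_on_const chart_image_openin)

lemma smooth_fun_on_add:
  assumes "smooth_manifold M" "smooth_fun_on M W h" "smooth_fun_on M W k"
  shows "smooth_fun_on M W (h + k)"
proof (rule smooth_fun_onI)
  show W: "openin (mtop M) W"
    using assms(2) by (rule smooth_fun_on_imp_openin)
  fix U \<phi> assume U: "(U, \<phi>) \<in> atlas M"
  from smooth_on_add[OF chart_image_openin[OF assms(1) U W] assms(2,3)[THEN smooth_fun_onD, OF U]]
  show "smooth_on (mdim M) (\<phi> ` (U \<inter> W)) (\<lambda>x. (h + k) (inv_into U \<phi> x))"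
    by (simp add: plus_fun_def)
qed

lemma smooth_fun_on_mult:
  assumes "smooth_manifold M" "smooth_fun_on M W h" "smooth_fun_on M W k"
  shows "smooth_fun_on M W (h * k)"
proof (rule smooth_fun_onI)
  show W: "openin (mtop M) W"
    using assms(2) by (rule smooth_fun_on_imp_openin)
  fix U \<phi> assume U: "(U, \<phi>) \<in> atlas M"
  from smooth_on_mult[OF chart_image_openin[OF assms(1) U W] assms(2,3)[THEN smooth_fun_onD, OF U]]
  show "smooth_on (mdim M) (\<phi> ` (U \<inter> W)) (\<lambda>x. (h * k) (inv_into U \<phi> x))"
    by (simp add: times_fun_def)
qed

lemma inv_into_chart:
  assumes "smooth_manifold M" "(U, \<phi>) \<in> atlas M" "q \<in> U"
  shows "inv_into U \<phi> (\<phi> q) = q"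
  using chart_inj_on[OF assms(1,2)] assms(3) by (rule inv_into_f_f)

lemma smooth_fun_on_cong:
  assumes M: "smooth_manifold M" and h: "smooth_fun_on M W h" and eq: "\<And>q. q \<in> W \<Longrightarrow> h q = k q"
  shows "smooth_fun_on M W k"
proof (rule smooth_fun_onI)
  fix U \<phi> assume U: "(U, \<phi>) \<in> atlas M"
  show "smooth_on (mdim M) (\<phi> ` (U \<inter> W)) (\<lambda>x. k (inv_into U \<phi> x))"
    by (rule smooth_on_cong[OF chart_image_openin[OF M U smooth_fun_on_imp_openin[OF h]] _ smooth_fun_onD[OF h U]])
      (auto simp: inv_into_chart[OF M U] eq)
qed (rule smooth_fun_on_imp_openin[OF h])

text \<open>Here \<open>\<psi>\<close> is either a chart of \<open>M\<close> or a chart of another manifold precomposed with a smooth map.\<close>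

lemma smooth_fun_on_compose_chart:
  assumes M: "smooth_manifold M" and W: "openin (mtop M) W" and B: "openin (Euclidean_space n) B"
    and g: "smooth_on n B g" and WB: "\<And>q. q \<in> W \<Longrightarrow> \<psi> q \<in> B"
    and \<psi>: "\<And>U \<phi> l. (U, \<phi>) \<in> atlas M \<Longrightarrow> l < n \<Longrightarrow> smooth_on (mdim M) (\<phi> ` (U \<inter> W)) (\<lambda>x. \<psi> (inv_into U \<phi> x) l)"
  shows "smooth_fun_on M W (\<lambda>q. g (\<psi> q))"
proof (rule smooth_fun_onI[OF W])
  fix U \<phi> assume U: "(U, \<phi>) \<in> atlas M"
  have "\<psi> (inv_into U \<phi> x) \<in> B" if "x \<in> \<phi> ` (U \<inter> W)" for x
    using that WB by (auto simp: inv_into_chart[OF M U])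
  from smooth_on_compose[OF chart_image_openin[OF M U W] B this g \<psi>[OF U]]
  show "smooth_on (mdim M) (\<phi> ` (U \<inter> W)) (\<lambda>x. g (\<psi> (inv_into U \<phi> x)))" .
qed

text \<open>Smoothness in one chart gives smoothness in all: the transition maps, smooth by
  \<open>smooth_manifold\<close>, are the inner functions.\<close>

lemma smooth_fun_on_coordinates:
  assumes M: "smooth_manifold M" and V: "(V, \<psi>) \<in> atlas M"
    and B: "openin (Euclidean_space (mdim M)) B" and g: "smooth_on (mdim M) B g"
  shows "smooth_fun_on M {q \<in> V. \<psi> q \<in> B} (\<lambda>q. g (\<psi> q))"
proof (rule smooth_fun_on_compose_chart[OF M chart_preimage_openin[OF M V B] B g])
  fix U \<phi> l assume "(U, \<phi>) \<in> atlas M" "l < mdim M"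
  then have "smooth_on (mdim M) (\<phi> ` (U \<inter> V)) (\<lambda>x. \<psi> (inv_into U \<phi> x) l)"
    using M V unfolding smooth_manifold_def by blast
  then show "smooth_on (mdim M) (\<phi> ` (U \<inter> {q \<in> V. \<psi> q \<in> B})) (\<lambda>x. \<psi> (inv_into U \<phi> x) l)"
    by (rule smooth_on_subset) auto
qed simp

section \<open>Germs of smooth functions\<close>

lemma smooth_near_points: "smooth_near M p h \<Longrightarrow> p \<in> points M"
  unfolding smooth_near_def by (meson openin_subset smooth_fun_on_imp_openin subsetD)

lemma smooth_near_common:
  assumes "smooth_near M p h" "smooth_near M p k"
  obtains W where "p \<in> W" "smooth_fun_on M W h" "smooth_fun_on M W k"
proof -
  obtain W W' where W: "p \<in> W" "smooth_fun_on M W h" "p \<in> W'" "smooth_fun_on M W' k"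
    using assms unfolding smooth_near_def by blast
  then have "openin (mtop M) (W \<inter> W')"
    by (blast intro: smooth_fun_on_imp_openin)
  then have "smooth_fun_on M (W \<inter> W') h" "smooth_fun_on M (W \<inter> W') k"
    using W by (auto intro: smooth_fun_on_subset)
  then show ?thesis using W that by blast
qed

lemma smooth_near_const: "smooth_manifold M \<Longrightarrow> p \<in> points M \<Longrightarrow> smooth_near M p (\<lambda>q. c)"
  unfolding smooth_near_def by (intro exI[of _ "points M"]) (simp add: smooth_fun_on_const)

lemma smooth_near_add:
  assumes "smooth_manifold M" "smooth_near M p h" "smooth_near M p k"
  shows "smooth_near M p (h + k)"
  using smooth_near_common[OF assms(2,3)] smooth_fun_on_add[OF assms(1)] unfolding smooth_near_def by metis

lemma smooth_near_mult:
  assumes "smooth_manifold M" "smooth_near M p h" "smooth_near M p k"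
  shows "smooth_near M p (h * k)"
  using smooth_near_common[OF assms(2,3)] smooth_fun_on_mult[OF assms(1)] unfolding smooth_near_def by metis

lemma smooth_near_scaleR:
  assumes "smooth_manifold M" "smooth_near M p h"
  shows "smooth_near M p (c *\<^sub>R h)"
proof -
  have "c *\<^sub>R h = (\<lambda>q. c) * h"
    by (simp add: scaleR_fun_def times_fun_def)
  then show ?thesis
    using smooth_near_mult[OF assms(1) smooth_near_const assms(2)] assms smooth_near_points by metis
qed

lemma smooth_near_sum:
  assumes M: "smooth_manifold M" and "p \<in> points M" and "\<And>l. l \<in> L \<Longrightarrow> smooth_near M p (h l)"
  shows "smooth_near M p (\<Sum>l\<in>L. h l)"
proof -
  have zero: "smooth_near M p 0"
    using smooth_near_const[OF M assms(2), of 0] by (simp add: zero_fun_def)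
  show ?thesis
    using assms(3) by (induction L rule: infinite_finite_induct) (simp_all add: zero smooth_near_add[OF M])
qed

lemma smooth_near_coordinates:
  assumes M: "smooth_manifold M" and V: "(V, \<psi>) \<in> atlas M" "p \<in> V"
    and B: "openin (Euclidean_space (mdim M)) B" "\<psi> p \<in> B" and g: "smooth_on (mdim M) B g"
  shows "smooth_near M p (\<lambda>q. g (\<psi> q))"
  unfolding smooth_near_def
  by (intro exI[of _ "{q \<in> V. \<psi> q \<in> B}"] conjI smooth_fun_on_coordinates[OF M V(1) B(1) g]) (simp add: V B)

lemma smooth_near_coordinate:
  assumes M: "smooth_manifold M" and V: "(V, \<psi>) \<in> atlas M" "p \<in> V"
  shows "smooth_near M p (\<lambda>q. \<psi> q l)"
proof (rule smooth_near_coordinates[OF M V])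
  have "\<psi> ` (V \<inter> V) = \<psi> ` V" by simp
  then show "openin (Euclidean_space (mdim M)) (\<psi> ` V)"
    using chart_image_openin[OF M V(1) chart_openin[OF M V(1)]] by simp
  then show "smooth_on (mdim M) (\<psi> ` V) (\<lambda>x. x l)"
    by (rule smooth_on_coordinate)
qed (use V in simp)

text \<open>Near \<open>p\<close>, \<open>h \<circ> f\<close> is the coordinate expression of
  \<open>h\<close> in a chart \<open>\<psi>\<close> of \<open>N\<close>, composed with
  \<open>\<psi> \<circ> f\<close>; \<open>smooth_map\<close> makes the latter smooth in every chart
  of \<open>M\<close>. On \<open>W'\<close> both factors are under control.\<close>

lemma smooth_near_compose:
  assumes M: "smooth_manifold M" and N: "smooth_manifold N" and f: "smooth_map M N f"
    and p: "p \<in> points M" and h: "smooth_near N (f p) h"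
  shows "smooth_near M p (h \<circ> f)"
proof -
  obtain W where W: "f p \<in> W" "smooth_fun_on N W h"
    using h unfolding smooth_near_def by blast
  obtain V \<psi> where V: "(V, \<psi>) \<in> atlas N" "f p \<in> V"
    using chart_exists[OF N smooth_near_points[OF h]] by blast
  define W' where "W' = {q \<in> points M. f q \<in> V \<inter> W}"
  have "openin (mtop N) (V \<inter> W)"
    using chart_openin[OF N V(1)] smooth_fun_on_imp_openin[OF W(2)] by (rule openin_Int)
  moreover have "continuous_map (mtop M) (mtop N) f"
    using f by (simp only: smooth_map_def)
  ultimately have W': "openin (mtop M) W'"
    unfolding W'_def by (rule openin_continuous_map_preimage[rotated])
  have "smooth_fun_on M W' (\<lambda>q. h (inv_into V \<psi> (\<psi> (f q))))"
  proof (rule smooth_fun_on_compose_chart[OF M W', where g = "\<lambda>x. h (inv_into V \<psi> x)" and \<psi> = "\<lambda>q. \<psi> (f q)"])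
    show "openin (Euclidean_space (mdim N)) (\<psi> ` (V \<inter> W))"
      using W(2) by (intro chart_image_openin[OF N V(1)] smooth_fun_on_imp_openin)
    show "smooth_on (mdim N) (\<psi> ` (V \<inter> W)) (\<lambda>x. h (inv_into V \<psi> x))"
      by (rule smooth_fun_onD[OF W(2) V(1)])
    fix U \<phi> l assume "(U, \<phi>) \<in> atlas M" "l < mdim N"
    then have "smooth_on (mdim M) (\<phi> ` (U \<inter> f -` V)) (\<lambda>x. \<psi> (f (inv_into U \<phi> x)) l)"
      using f V(1) unfolding smooth_map_def by blast
    then show "smooth_on (mdim M) (\<phi> ` (U \<inter> W')) (\<lambda>x. \<psi> (f (inv_into U \<phi> x)) l)"
      by (rule smooth_on_subset) (auto simp: W'_def)
  qed (auto simp: W'_def)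
  then have "smooth_fun_on M W' (h \<circ> f)"
    by (rule smooth_fun_on_cong[OF M]) (simp add: W'_def inv_into_chart[OF N V(1)])
  moreover have "p \<in> W'"
    using p W(1) V(2) by (simp add: W'_def)
  ultimately show ?thesis
    unfolding smooth_near_def by blast
qed

section \<open>Tangent spaces\<close>

lemma sum_fun_apply: "(\<Sum>l\<in>L. f l) x = (\<Sum>l\<in>L. f l x)"
  by (induction L rule: infinite_finite_induct) auto

lemma tangent_space_add:
  "X \<in> tangent_space M p \<Longrightarrow> smooth_near M p h \<Longrightarrow> smooth_near M p k \<Longrightarrow> X (h + k) = X h + X k"
  unfolding tangent_space_def by blast

lemma tangent_space_mult:
  "X \<in> tangent_space M p \<Longrightarrow> smooth_near M p h \<Longrightarrow> smooth_near M p k \<Longrightarrow> X (h * k) = h p * X k + k p * X h"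
  unfolding tangent_space_def by blast

lemma tangent_space_scaleR:
  "X \<in> tangent_space M p \<Longrightarrow> smooth_near M p h \<Longrightarrow> X (c *\<^sub>R h) = c * X h"
  unfolding tangent_space_def by blast

lemma tangent_space_not_smooth: "X \<in> tangent_space M p \<Longrightarrow> \<not> smooth_near M p h \<Longrightarrow> X h = 0"
  unfolding tangent_space_def by blast

lemma tangent_space_cong:
  "X \<in> tangent_space M p \<Longrightarrow> smooth_near M p h \<Longrightarrow> smooth_near M p k \<Longrightarrow>
    openin (mtop M) W \<Longrightarrow> p \<in> W \<Longrightarrow> (\<And>q. q \<in> W \<Longrightarrow> h q = k q) \<Longrightarrow> X h = X k"
  unfolding tangent_space_def by blast

lemma tangent_spaceI:
  assumes "\<And>h k. smooth_near M p h \<Longrightarrow> smooth_near M p k \<Longrightarrow> X (h + k) = X h + X k"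
    and "\<And>h k. smooth_near M p h \<Longrightarrow> smooth_near M p k \<Longrightarrow> X (h * k) = h p * X k + k p * X h"
    and "\<And>h k W. smooth_near M p h \<Longrightarrow> smooth_near M p k \<Longrightarrow> openin (mtop M) W \<Longrightarrow> p \<in> W \<Longrightarrow>
      (\<And>q. q \<in> W \<Longrightarrow> h q = k q) \<Longrightarrow> X h = X k"
    and "\<And>c h. smooth_near M p h \<Longrightarrow> X (c *\<^sub>R h) = c * X h"
    and "\<And>h. \<not> smooth_near M p h \<Longrightarrow> X h = 0"
  shows "X \<in> tangent_space M p"
proof -
  have "X h = X k" if "smooth_near M p h" "smooth_near M p k"
    and "\<exists>W. openin (mtop M) W \<and> p \<in> W \<and> (\<forall>q\<in>W. h q = k q)" for h k
    using that(3) assms(3)[OF that(1,2)] by blast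
  with assms(1,2,4,5) show ?thesis
    unfolding tangent_space_def by simp
qed

text \<open>The convention that vectors vanish off germs is linear too, so tangent spaces are
  subspaces of the whole function space and general linear algebra applies to them.\<close>

lemma subspace_tangent_space: "subspace (tangent_space M p)"
proof (rule subspaceI)
  show "0 \<in> tangent_space M p"
    by (rule tangent_spaceI) simp_all
next
  fix X Y assume XY: "X \<in> tangent_space M p" "Y \<in> tangent_space M p"
  show "X + Y \<in> tangent_space M p"
  proof (rule tangent_spaceI)
    fix h k W assume "smooth_near M p h" "smooth_near M p k" "openin (mtop M) W" "p \<in> W" "\<And>q. q \<in> W \<Longrightarrow> h q = k q"
    then show "(X + Y) h = (X + Y) k"
      using XY[THEN tangent_space_cong, of h k W] by simp
  qed (use XY in \<open>simp_all add: tangent_space_add tangent_space_mult tangent_space_scaleR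
      tangent_space_not_smooth algebra_simps\<close>)
next
  fix c X assume X: "X \<in> tangent_space M p"
  show "c *\<^sub>R X \<in> tangent_space M p"
  proof (rule tangent_spaceI)
    fix h k W assume "smooth_near M p h" "smooth_near M p k" "openin (mtop M) W" "p \<in> W" "\<And>q. q \<in> W \<Longrightarrow> h q = k q"
    then show "(c *\<^sub>R X) h = (c *\<^sub>R X) k"
      using tangent_space_cong[OF X, of h k W] by (simp add: scaleR_fun_def)
  qed (use X in \<open>simp_all add: scaleR_fun_def[of c X] tangent_space_add tangent_space_mult tangent_space_scaleR
      tangent_space_not_smooth algebra_simps\<close>)
qed

text \<open>The product rule for \<open>1 * 1 = 1\<close> gives \<open>X 1 = X 1 + X 1\<close>;
  homogeneity extends \<open>X 1 = 0\<close> to all constants.\<close>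

lemma tangent_space_const:
  assumes M: "smooth_manifold M" and p: "p \<in> points M" and X: "X \<in> tangent_space M p"
  shows "X (\<lambda>q. c) = 0"
proof -
  note s = smooth_near_const[OF M p, of 1]
  have "X ((\<lambda>q. 1) * (\<lambda>q. 1)) = X (\<lambda>q. 1) + X (\<lambda>q. 1)"
    using tangent_space_mult[OF X s s] by simp
  then have "X (\<lambda>q. 1) = 0"
    by (simp add: times_fun_def)
  then show ?thesis
    using tangent_space_scaleR[OF X s, of c] by (simp add: scaleR_fun_def)
qed

lemma tangent_space_sum:
  assumes M: "smooth_manifold M" and p: "p \<in> points M" and X: "X \<in> tangent_space M p"
    and "\<And>l. l \<in> L \<Longrightarrow> smooth_near M p (h l)"
  shows "X (\<Sum>l\<in>L. h l) = (\<Sum>l\<in>L. X (h l))"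
proof -
  have zero: "X 0 = 0"
    using tangent_space_const[OF M p X, of 0] by (simp add: zero_fun_def)
  show ?thesis
    using assms(4)
    by (induction L rule: infinite_finite_induct)
      (simp_all add: zero tangent_space_add[OF X] smooth_near_sum[OF M p])
qed

text \<open>The coordinate derivation along the \<open>l\<close>-th axis of the chart. The value 0
  off germs is the one that \<open>tangent_space\<close> prescribes.\<close>

definition coord_vector :: "'p manifold \<Rightarrow> 'p set \<Rightarrow> ('p \<Rightarrow> nat \<Rightarrow> real) \<Rightarrow> 'p \<Rightarrow> nat \<Rightarrow> 'p tvec" where
  "coord_vector M U \<phi> p l =
     (\<lambda>h. if smooth_near M p h then partial_deriv l (\<lambda>x. h (inv_into U \<phi> x)) (\<phi> p) else 0)"

lemma has_partial_deriv_chart: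
  assumes U: "(U, \<phi>) \<in> atlas M" "p \<in> U" and l: "l < mdim M" and h: "smooth_near M p h"
  shows "((\<lambda>t. h (inv_into U \<phi> ((\<phi> p)(l := t)))) has_field_derivative coord_vector M U \<phi> p l h) (at (\<phi> p l))"
proof -
  obtain W where W: "p \<in> W" "smooth_fun_on M W h"
    using h unfolding smooth_near_def by blast
  show ?thesis
    using smooth_on_has_partial_deriv[OF smooth_fun_onD[OF W(2) U(1)] _ l, of "\<phi> p"] U(2) W(1) h
    by (simp add: coord_vector_def del: fun_upd_apply)
qed

lemma coord_vectorI:
  assumes "smooth_near M p h"
    "((\<lambda>t. h (inv_into U \<phi> ((\<phi> p)(l := t)))) has_field_derivative d) (at (\<phi> p l))"
  shows "coord_vector M U \<phi> p l h = d"
  using partial_derivI[OF assms(2)] assms(1) by (simp add: coord_vector_def)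

lemma coord_vector_mem:
  assumes M: "smooth_manifold M" and U: "(U, \<phi>) \<in> atlas M" "p \<in> U" and l: "l < mdim M"
  shows "coord_vector M U \<phi> p l \<in> tangent_space M p"
proof (rule tangent_spaceI)
  fix h k assume hk: "smooth_near M p h" "smooth_near M p k"
  note d = hk[THEN has_partial_deriv_chart[OF U l]]
  show "coord_vector M U \<phi> p l (h + k) = coord_vector M U \<phi> p l h + coord_vector M U \<phi> p l k"
    using DERIV_add[OF d] by (intro coord_vectorI smooth_near_add[OF M hk]) (simp del: fun_upd_apply)
  show "coord_vector M U \<phi> p l (h * k) = h p * coord_vector M U \<phi> p l k + k p * coord_vector M U \<phi> p l h"
    using DERIV_mult[OF d]
    by (intro coord_vectorI smooth_near_mult[OF M hk])
      (simp add: inv_into_chart[OF M U] algebra_simps del: fun_upd_apply)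
  fix W assume W: "openin (mtop M) W" "p \<in> W" and eq: "\<And>q. q \<in> W \<Longrightarrow> h q = k q"
  show "coord_vector M U \<phi> p l h = coord_vector M U \<phi> p l k"
  proof (rule coord_vectorI[OF hk(1)])
    have "((\<lambda>t. h (inv_into U \<phi> ((\<phi> p)(l := t)))) has_field_derivative e) (at (\<phi> p l)) \<longleftrightarrow>
          ((\<lambda>t. k (inv_into U \<phi> ((\<phi> p)(l := t)))) has_field_derivative e) (at (\<phi> p l))" for e
    proof (rule has_field_derivative_fun_upd_cong[OF chart_image_openin[OF M U(1) W(1)] _ _ l])
      show "h (inv_into U \<phi> x) = k (inv_into U \<phi> x)" if "x \<in> \<phi> ` (U \<inter> W)" for x
        using that eq by (auto simp: inv_into_chart[OF M U(1)])
    qed (use U(2) W(2) in simp)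
    then show "((\<lambda>t. h (inv_into U \<phi> ((\<phi> p)(l := t)))) has_field_derivative coord_vector M U \<phi> p l k) (at (\<phi> p l))"
      using d(2) by (simp only:)
  qed
next
  fix c h assume h: "smooth_near M p h"
  show "coord_vector M U \<phi> p l (c *\<^sub>R h) = c * coord_vector M U \<phi> p l h"
    using DERIV_cmult[OF has_partial_deriv_chart[OF U l h], of c]
    by (intro coord_vectorI smooth_near_scaleR[OF M h]) (simp add: scaleR_fun_def del: fun_upd_apply)
qed (simp add: coord_vector_def)

text \<open>Coordinates and coordinate derivations are dual; this yields the coefficients in
  \<open>tangent_space_expansion\<close> and independence in \<open>tangent_space_basis\<close>. In
  the chart, the coordinate function becomes \<open>\<lambda>x. x k\<close> on the chart image only,
  hence the local congruence.\<close>

lemma coord_vector_coordinate: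
  assumes M: "smooth_manifold M" and U: "(U, \<phi>) \<in> atlas M" "p \<in> U" and l: "l < mdim M"
  shows "coord_vector M U \<phi> p l (\<lambda>q. \<phi> q k) = (if l = k then 1 else 0)"
proof (rule coord_vectorI[OF smooth_near_coordinate[OF M U]])
  have "openin (Euclidean_space (mdim M)) (\<phi> ` (U \<inter> U))"
    by (rule chart_image_openin[OF M U(1) chart_openin[OF M U(1)]])
  moreover have "x k = \<phi> (inv_into U \<phi> x) k" if "x \<in> \<phi> ` (U \<inter> U)" for x
    using that by (simp add: f_inv_into_f)
  moreover have "((\<lambda>t. ((\<phi> p)(l := t)) k) has_field_derivative (if l = k then 1 else 0)) (at (\<phi> p l))"
    by (auto intro!: derivative_eq_intros)
  ultimately show "((\<lambda>t. \<phi> (inv_into U \<phi> ((\<phi> p)(l := t))) k) has_field_derivative (if l = k then 1 else 0)) (at (\<phi> p l))"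
    using has_field_derivative_fun_upd_cong[of "mdim M" "\<phi> ` (U \<inter> U)" "\<lambda>x. x k" "\<lambda>x. \<phi> (inv_into U \<phi> x) k" "\<phi> p" l]
      U(2) l by blast
qed

text \<open>By Hadamard's lemma a derivation is determined by its values on the coordinates.\<close>

lemma tangent_space_coordinates:
  assumes M: "smooth_manifold M" and U: "(U, \<phi>) \<in> atlas M" "p \<in> U" and h: "smooth_near M p h"
  shows "\<exists>\<gamma>. \<forall>X\<in>tangent_space M p. X h = (\<Sum>l<mdim M. \<gamma> l * X (\<lambda>q. \<phi> q l))"
proof -
  let ?n = "mdim M" and ?f = "\<lambda>x. h (inv_into U \<phi> x)"
  obtain W where W: "p \<in> W" "smooth_fun_on M W h"
    using h unfolding smooth_near_def by blast
  have p: "p \<in> points M"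
    using smooth_near_points[OF h] .
  define a where "a = \<phi> p"
  have V: "openin (Euclidean_space ?n) (\<phi> ` (U \<inter> W))" "a \<in> \<phi> ` (U \<inter> W)"
    using chart_image_openin[OF M U(1) smooth_fun_on_imp_openin[OF W(2)]] U(2) W(1) by (auto simp: a_def)
  have a: "a l = 0" if "?n \<le> l" for l
    using Euclidean_spaceD[OF V that] .
  obtain r where r: "r > 0" "coord_box ?n a r \<subseteq> \<phi> ` (U \<inter> W)"
    using coord_box_exists[OF V] by blast
  let ?B = "coord_box ?n a r"
  have f: "smooth_on ?n ?B ?f"
    using smooth_on_subset[OF smooth_fun_onD[OF W(2) U(1)] r(2)] .
  have aB: "a \<in> ?B"
    using a r(1) by (simp add: coord_box_def)
  define g where "g l = radial_integral 0 a (partial_deriv l ?f)" for l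
  define G where "G l = (\<lambda>q. g l (\<phi> q))" for l
  \<comment> \<open>\<open>D l\<close> vanishes at \<open>p\<close>, so the product rule on
    \<open>D l * G l\<close> loses the term with \<open>X (G l)\<close>.\<close>
  define D where "D l = (\<lambda>q. \<phi> q l) + (\<lambda>q. - a l)" for l
  have G: "smooth_near M p (G l)" if "l < ?n" for l
    unfolding G_def g_def
  proof (rule smooth_near_coordinates[OF M U openin_coord_box])
    show "smooth_on ?n ?B (radial_integral 0 a (partial_deriv l ?f))"
      by (rule smooth_on_radial_integral[of ?n a, OF a smooth_on_partial_deriv[OF f that]])
  qed (use aB in \<open>simp add: a_def\<close>)
  note coordinate = smooth_near_coordinate[OF M U]
  have D: "smooth_near M p (D l)" for l
    unfolding D_def by (intro smooth_near_add[OF M coordinate] smooth_near_const[OF M p])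
  \<comment> \<open>The Hadamard expansion as a function on the manifold. It is shown to agree with
    \<open>h\<close> near \<open>p\<close>, which is enough for derivations of germs.\<close>
  define k where "k = (\<lambda>q. h p) + (\<Sum>l<?n. D l * G l)"
  have S: "smooth_near M p (\<Sum>l<?n. D l * G l)"
    using D G by (intro smooth_near_sum[OF M p] smooth_near_mult[OF M]) auto
  then have k: "smooth_near M p k"
    unfolding k_def by (intro smooth_near_add[OF M] smooth_near_const[OF M p])
  have hk: "h q = k q" if "q \<in> {q \<in> U. \<phi> q \<in> ?B}" for q
  proof -
    have "Ck_on (Suc 0) ?n ?B ?f"
      using f unfolding smooth_on_def by blast
    from hadamard[of ?n a, OF a this] that
    have "?f (\<phi> q) = ?f a + (\<Sum>l<?n. (\<phi> q l - a l) * g l (\<phi> q))"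
      unfolding g_def by blast
    then show ?thesis
      using that U by (simp add: k_def D_def G_def sum_fun_apply a_def inv_into_chart[OF M U(1)])
  qed
  show ?thesis
  proof (intro exI ballI)
    fix X assume X: "X \<in> tangent_space M p"
    have XD: "X (D l * G l) = g l a * X (\<lambda>q. \<phi> q l)" if "l < ?n" for l
    proof -
      have "X (D l) = X (\<lambda>q. \<phi> q l)"
        using tangent_space_add[OF X coordinate smooth_near_const[OF M p]] tangent_space_const[OF M p X]
        by (simp add: D_def)
      then show ?thesis
        using tangent_space_mult[OF X D G[OF that], of l] by (simp add: D_def G_def a_def)
    qed
    have "X h = X k"
    proof (rule tangent_space_cong[OF X h k _ _ hk])
      show "openin (mtop M) {q \<in> U. \<phi> q \<in> ?B}"
        by (rule chart_preimage_openin[OF M U(1) openin_coord_box])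
    qed (use U(2) aB in \<open>simp_all add: a_def\<close>)
    also have "\<dots> = X (\<Sum>l<?n. D l * G l)"
      using tangent_space_add[OF X smooth_near_const[OF M p] S] tangent_space_const[OF M p X]
      by (simp add: k_def)
    also have "\<dots> = (\<Sum>l<?n. X (D l * G l))"
      using D G by (intro tangent_space_sum[OF M p X] smooth_near_mult[OF M]) auto
    also have "\<dots> = (\<Sum>l<?n. g l a * X (\<lambda>q. \<phi> q l))"
      by (intro sum.cong) (simp_all add: XD)
    finally show "X h = (\<Sum>l<?n. g l a * X (\<lambda>q. \<phi> q l))" .
  qed
qed

text \<open>The coefficients in \<open>tangent_space_coordinates\<close> depend on \<open>h\<close>
  but not on the derivation, so applying that formula to the coordinate derivations themselves
  identifies them.\<close>

lemma tangent_space_expansion: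
  assumes M: "smooth_manifold M" and U: "(U, \<phi>) \<in> atlas M" "p \<in> U" and X: "X \<in> tangent_space M p"
  shows "X = (\<Sum>l<mdim M. X (\<lambda>q. \<phi> q l) *\<^sub>R coord_vector M U \<phi> p l)"
proof
  fix h
  let ?E = "coord_vector M U \<phi> p"
  show "X h = (\<Sum>l<mdim M. X (\<lambda>q. \<phi> q l) *\<^sub>R ?E l) h"
  proof (cases "smooth_near M p h")
    case True
    from tangent_space_coordinates[OF M U this]
    obtain \<gamma> where \<gamma>: "\<And>Y. Y \<in> tangent_space M p \<Longrightarrow> Y h = (\<Sum>l<mdim M. \<gamma> l * Y (\<lambda>q. \<phi> q l))"
      by blast
    have "?E l h = \<gamma> l" if "l < mdim M" for l
    proof -
      have "?E l h = (\<Sum>k<mdim M. if k = l then \<gamma> l else 0)"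
        unfolding \<gamma>[OF coord_vector_mem[OF M U that]]
        by (rule sum.cong) (auto simp: coord_vector_coordinate[OF M U that])
      then show ?thesis using that by simp
    qed
    then show ?thesis
      using \<gamma>[OF X] by (simp add: sum_fun_apply scaleR_fun_def mult.commute)
  next
    case False
    then show ?thesis
      using tangent_space_not_smooth[OF X] by (simp add: sum_fun_apply scaleR_fun_def coord_vector_def)
  qed
qed

lemma tangent_space_basis:
  assumes M: "smooth_manifold M" and p: "p \<in> points M"
  shows "\<exists>B. finite B \<and> card B = mdim M \<and> independent B \<and> span B = tangent_space M p"
proof -
  obtain U \<phi> where U: "(U, \<phi>) \<in> atlas M" "p \<in> U"
    using chart_exists[OF M p] by blast
  let ?E = "coord_vector M U \<phi> p" and ?n = "mdim M"
  let ?B = "?E ` {..<?n}"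
  have eval: "?E k (\<lambda>q. \<phi> q l) = (if k = l then 1 else 0)" if "k < ?n" for k l
    by (rule coord_vector_coordinate[OF M U that])
  have "inj_on ?E {..<?n}"
  proof (rule inj_onI)
    fix k l assume "k \<in> {..<?n}" "l \<in> {..<?n}" "?E k = ?E l"
    then show "k = l"
      using eval[of k l] eval[of l l] by (auto split: if_splits)
  qed
  then have "card ?B = ?n"
    by (simp add: card_image)
  moreover have "independent ?B"
    unfolding dependent_def
  proof clarify
    fix l assume l: "l < ?n" "?E l \<in> span (?B - {?E l})"
    \<comment> \<open>Evaluation at the \<open>l\<close>-th coordinate is a linear functional that
      kills the other coordinate derivations and is 1 on the \<open>l\<close>-th.\<close>
    have "subspace {Y::'a tvec. Y (\<lambda>q. \<phi> q l) = 0}"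
      by (rule subspaceI) (simp_all add: scaleR_fun_def)
    moreover have "?B - {?E l} \<subseteq> {Y. Y (\<lambda>q. \<phi> q l) = 0}"
      using eval by auto
    ultimately have "span (?B - {?E l}) \<subseteq> {Y. Y (\<lambda>q. \<phi> q l) = 0}"
      by (intro span_minimal)
    then show False
      using l eval[OF l(1), of l] by auto
  qed
  moreover have "span ?B = tangent_space M p"
  proof
    show "span ?B \<subseteq> tangent_space M p"
      using coord_vector_mem[OF M U] by (intro span_minimal subspace_tangent_space) auto
    show "tangent_space M p \<subseteq> span ?B"
    proof
      fix X assume "X \<in> tangent_space M p"
      then have "X = (\<Sum>l<?n. X (\<lambda>q. \<phi> q l) *\<^sub>R ?E l)"
        by (rule tangent_space_expansion[OF M U])
      also have "\<dots> \<in> span ?B"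
        by (intro span_sum span_scale span_base) auto
      finally show "X \<in> span ?B" .
    qed
  qed
  ultimately show ?thesis
    by blast
qed

text \<open>Linear on all functionals, derivations or not, because the guard in
  \<open>differential\<close> does not depend on the vector. So results on globally linear maps
  apply.\<close>

lemma linear_differential: "linear (differential N f p)"
  by (rule linearI) (auto simp: differential_def scaleR_fun_def fun_eq_iff)

text \<open>Precomposition with \<open>f\<close> is a homomorphism from the germs at
  \<open>f p\<close> to the germs at \<open>p\<close>.\<close>

lemma differential_mem:
  assumes M: "smooth_manifold M" and N: "smooth_manifold N" and f: "smooth_map M N f"
    and p: "p \<in> points M" and X: "X \<in> tangent_space M p"
  shows "differential N f p X \<in> tangent_space N (f p)"
proof (rule tangent_spaceI)
  note smooth = smooth_near_compose[OF M N f p]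
  fix h k assume hk: "smooth_near N (f p) h" "smooth_near N (f p) k"
  have "(h + k) \<circ> f = (h \<circ> f) + (k \<circ> f)" "(h * k) \<circ> f = (h \<circ> f) * (k \<circ> f)"
    by auto
  then show "differential N f p X (h + k) = differential N f p X h + differential N f p X k"
    "differential N f p X (h * k) = h (f p) * differential N f p X k + k (f p) * differential N f p X h"
    using hk smooth_near_add[OF N hk] smooth_near_mult[OF N hk]
      tangent_space_add[OF X hk[THEN smooth]] tangent_space_mult[OF X hk[THEN smooth]]
    by (simp_all add: differential_def)
  fix W assume W: "openin (mtop N) W" "f p \<in> W" and eq: "\<And>q. q \<in> W \<Longrightarrow> h q = k q"
  have "continuous_map (mtop M) (mtop N) f"
    using f by (simp only: smooth_map_def)
  from openin_continuous_map_preimage[OF this W(1)]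
  have "X (h \<circ> f) = X (k \<circ> f)"
    by (rule tangent_space_cong[OF X hk[THEN smooth]]) (use p W(2) eq in simp_all)
  then show "differential N f p X h = differential N f p X k"
    using hk by (simp add: differential_def)
next
  fix c h assume h: "smooth_near N (f p) h"
  have "(c *\<^sub>R h) \<circ> f = c *\<^sub>R (h \<circ> f)"
    by (auto simp: scaleR_fun_def)
  then show "differential N f p X (c *\<^sub>R h) = c * differential N f p X h"
    using h smooth_near_scaleR[OF N h] tangent_space_scaleR[OF X smooth_near_compose[OF M N f p h]]
    by (simp add: differential_def)
qed (simp add: differential_def)

text \<open>Where the outer guard holds, \<open>smooth_near_compose\<close> makes the inner one
  hold; where it fails, both sides are 0.\<close>

lemma differential_compose:
  assumes N: "smooth_manifold N" and L: "smooth_manifold L" and j: "smooth_map N L j" and "i p \<in> points N"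
  shows "differential L (j \<circ> i) p X = differential L j (i p) (differential N i p X)"
  using smooth_near_compose[OF N L j assms(4)] by (auto simp: differential_def comp_assoc)

section \<open>Hypersurfaces\<close>

lemma
  assumes "riemannian_metric M g" "p \<in> points M"
  shows riemannian_metric_sym: "v \<in> tangent_space M p \<Longrightarrow> w \<in> tangent_space M p \<Longrightarrow> g p v w = g p w v"
    and riemannian_metric_add_right: "v \<in> tangent_space M p \<Longrightarrow> w \<in> tangent_space M p \<Longrightarrow>
      w' \<in> tangent_space M p \<Longrightarrow> g p v (w + w') = g p v w + g p v w'"
    and riemannian_metric_scaleR_right: "v \<in> tangent_space M p \<Longrightarrow> w \<in> tangent_space M p \<Longrightarrow>
      g p v (c *\<^sub>R w) = c * g p v w"
    and riemannian_metric_pos: "v \<in> tangent_space M p \<Longrightarrow> v \<noteq> 0 \<Longrightarrow> g p v v > 0"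
  using assms unfolding riemannian_metric_def by blast+

lemma riemannian_metric_add_left:
  assumes "riemannian_metric M g" "p \<in> points M"
    and "u \<in> tangent_space M p" "v \<in> tangent_space M p" "w \<in> tangent_space M p"
  shows "g p (u + v) w = g p u w + g p v w"
  using assms subspace_add[OF subspace_tangent_space assms(3,4)]
  by (simp add: riemannian_metric_sym[of M g p _ w] riemannian_metric_add_right)

lemma riemannian_metric_scaleR_left:
  assumes "riemannian_metric M g" "p \<in> points M" "v \<in> tangent_space M p" "w \<in> tangent_space M p"
  shows "g p (c *\<^sub>R v) w = c * g p v w"
  using assms subspace_scale[OF subspace_tangent_space assms(3)]
  by (simp add: riemannian_metric_sym[of M g p _ w] riemannian_metric_scaleR_right)

lemma subspace_orthogonal:
  assumes g: "riemannian_metric M g" "p \<in> points M" and v: "v \<in> tangent_space M p"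
  shows "subspace {w \<in> tangent_space M p. g p v w = 0}"
proof (rule subspaceI)
  have "g p v (0 *\<^sub>R 0) = 0"
    using riemannian_metric_scaleR_right[OF g v subspace_0[OF subspace_tangent_space], of 0] by simp
  then show "0 \<in> {w \<in> tangent_space M p. g p v w = 0}"
    using subspace_0[OF subspace_tangent_space] by simp
qed (use subspace_add[OF subspace_tangent_space] subspace_scale[OF subspace_tangent_space] in
    \<open>auto simp: riemannian_metric_add_right[OF g v] riemannian_metric_scaleR_right[OF g v]\<close>)

text \<open>An intersection of orthogonal complements. It keeps the vector \<open>w\<close> formed
  in \<open>hypersurface_normal_space\<close> inside the normal space.\<close>

lemma subspace_normal_space:
  assumes M: "smooth_manifold M" and N: "smooth_manifold N" and f: "smooth_map M N f"
    and g: "riemannian_metric N g" and p: "p \<in> points M"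
  shows "subspace (normal_space M N g f p)"
proof -
  have fp: "f p \<in> points N"
    using f p by (auto simp: smooth_map_def continuous_map_def)
  have "n \<in> normal_space M N g f p \<longleftrightarrow>
      n \<in> tangent_space N (f p) \<inter>
        (\<Inter>v\<in>tangent_space M p. {n \<in> tangent_space N (f p). g (f p) (differential N f p v) n = 0})" for n
    using differential_mem[OF M N f p] riemannian_metric_sym[OF g fp]
    by (auto simp: normal_space_def)
  then have "normal_space M N g f p = tangent_space N (f p) \<inter>
      (\<Inter>v\<in>tangent_space M p. {n \<in> tangent_space N (f p). g (f p) (differential N f p v) n = 0})"
    by blast
  also have "subspace \<dots>"
    using differential_mem[OF M N f p]
    by (intro subspace_inter subspace_tangent_space subspace_Inter) (auto intro: subspace_orthogonal[OF g fp])
  finally show ?thesis .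
qed

text \<open>A normal vector \<open>n - g(n, \<nu>) \<nu> \<noteq> 0\<close> together with \<open>\<nu>\<close> and the image of a basis of the tangent
  space would give \<open>mdim N + 1\<close> independent vectors in \<open>T\<^bsub>f p\<^esub>N\<close>.\<close>

lemma hypersurface_normal_space:
  assumes M: "smooth_manifold M" and N: "smooth_manifold N" and g: "riemannian_metric N g"
    and f: "immersion M N f" and dim: "mdim N = mdim M + 1" and \<nu>: "unit_normal M N g f \<nu>"
    and p: "p \<in> points M" and n: "n \<in> normal_space M N g f p"
  shows "n = g (f p) n (\<nu> p) *\<^sub>R \<nu> p"
proof (rule ccontr)
  assume neq: "n \<noteq> g (f p) n (\<nu> p) *\<^sub>R \<nu> p"
  have smooth: "smooth_map M N f" and inj: "inj_on (differential N f p) (tangent_space M p)"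
    using f p by (auto simp: immersion_def)
  have fp: "f p \<in> points N"
    using smooth p by (auto simp: smooth_map_def continuous_map_def)
  let ?d = "differential N f p" and ?g = "g (f p)" and ?T = "tangent_space N (f p)"
  have nu: "\<nu> p \<in> normal_space M N g f p" "?g (\<nu> p) (\<nu> p) = 1"
    using \<nu> p by (auto simp: unit_normal_def)
  have T: "x \<in> ?T" if "x \<in> normal_space M N g f p" for x
    using that by (simp add: normal_space_def)
  define w where "w = n + (- ?g n (\<nu> p)) *\<^sub>R \<nu> p"
  note sub = subspace_normal_space[OF M N smooth g p]
  have w: "w \<in> normal_space M N g f p"
    unfolding w_def by (intro subspace_add[OF sub n] subspace_scale[OF sub nu(1)])
  have w0: "w \<noteq> 0"
    using neq by (simp add: w_def)
  have "?g (n + c *\<^sub>R \<nu> p) (\<nu> p) = ?g n (\<nu> p) + c" for c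
    using n nu
    by (simp add: T subspace_scale[OF subspace_tangent_space] riemannian_metric_add_left[OF g fp] riemannian_metric_scaleR_left[OF g fp])
  from this[of "- ?g n (\<nu> p)"] have w_nu: "?g w (\<nu> p) = 0"
    unfolding w_def by linarith
  obtain B where B: "finite B" "card B = mdim M" "independent B" "span B = tangent_space M p"
    using tangent_space_basis[OF M p] by blast
  obtain C where C: "finite C" "card C = mdim N" "span C = ?T"
    using tangent_space_basis[OF N fp] by blast
  have BT: "b \<in> tangent_space M p" if "b \<in> B" for b
    using span_base[OF that] B(4) by simp
  have dB: "independent (?d ` B)"
    using linear_independent_injective_image[OF linear_differential B(3)] inj B(4) by simp
  have card_dB: "card (?d ` B) = mdim M"
    using card_image[OF inj_on_subset[OF inj]] span_superset[of B] B(2,4) by simp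
  \<comment> \<open>Orthogonality to the image of \<open>B\<close> passes to its span, but
    \<open>\<nu> p\<close> is not orthogonal to itself. The same argument then applies to
    \<open>w\<close>, which is orthogonal to \<open>\<nu> p\<close> as well.\<close>
  have nu_notin: "\<nu> p \<notin> span (?d ` B)"
  proof
    assume "\<nu> p \<in> span (?d ` B)"
    moreover have "?d ` B \<subseteq> {x \<in> ?T. ?g (\<nu> p) x = 0}"
      using nu(1) BT differential_mem[OF M N smooth p] by (auto simp: normal_space_def)
    ultimately have "\<nu> p \<in> {x \<in> ?T. ?g (\<nu> p) x = 0}"
      using span_minimal[OF _ subspace_orthogonal[OF g fp T[OF nu(1)]]] by blast
    then show False using nu(2) by simp
  qed
  have w_notin: "w \<notin> span (insert (\<nu> p) (?d ` B))"
  proof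
    assume "w \<in> span (insert (\<nu> p) (?d ` B))"
    moreover have "insert (\<nu> p) (?d ` B) \<subseteq> {x \<in> ?T. ?g w x = 0}"
      using w w_nu nu(1) BT differential_mem[OF M N smooth p] by (auto simp: normal_space_def)
    ultimately have "w \<in> {x \<in> ?T. ?g w x = 0}"
      using span_minimal[OF _ subspace_orthogonal[OF g fp T[OF w]]] by blast
    then show False
      using riemannian_metric_pos[OF g fp T[OF w] w0] by simp
  qed
  let ?S = "insert w (insert (\<nu> p) (?d ` B))"
  have "independent ?S"
    by (intro independent_insertI w_notin nu_notin dB)
  moreover have "?S \<subseteq> span C"
    using T w nu(1) BT differential_mem[OF M N smooth p] by (auto simp: C(3))
  ultimately have "card ?S \<le> mdim N"
    using independent_span_bound[OF C(1)] C(2) by auto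
  moreover have "\<nu> p \<notin> ?d ` B" "w \<notin> insert (\<nu> p) (?d ` B)"
    using nu_notin w_notin span_base by metis+
  then have "card ?S = mdim M + 2"
    using card_dB B(1) by simp
  ultimately show False
    using dim by simp
qed

theorem proposition5p2:
  fixes Mt :: "'a manifold" and Mb :: "'b manifold" and M :: "'c manifold"
    and gt :: "'a \<Rightarrow> 'a tvec \<Rightarrow> 'a tvec \<Rightarrow> real"
    and gb :: "'b \<Rightarrow> 'b tvec \<Rightarrow> 'b tvec \<Rightarrow> real"
    and g :: "'c \<Rightarrow> 'c tvec \<Rightarrow> 'c tvec \<Rightarrow> real"
    and Pt :: "'a \<Rightarrow> 'a tvec \<Rightarrow> 'a tvec"
    and Pb :: "'b \<Rightarrow> 'b tvec \<Rightarrow> 'b tvec"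
    and P :: "'c \<Rightarrow> 'c tvec \<Rightarrow> 'c tvec"
    and j :: "'b \<Rightarrow> 'a" and i :: "'c \<Rightarrow> 'b"
    and N2 :: "'b \<Rightarrow> 'a tvec" and N1 :: "'c \<Rightarrow> 'b tvec"
    and u2 :: "'b \<Rightarrow> 'b tvec \<Rightarrow> real" and u1 :: "'c \<Rightarrow> 'c tvec \<Rightarrow> real"
    and \<xi>2 :: "'b \<Rightarrow> 'b tvec" and \<xi>1 :: "'c \<Rightarrow> 'c tvec"
    and a22 :: "'b \<Rightarrow> real" and a11 a12 a21 :: "'c \<Rightarrow> real"
    and \<xi>2_tan :: "'c \<Rightarrow> 'c tvec" and \<xi>2_nor :: "'c \<Rightarrow> 'b tvec"
  assumes "almost_product_riemannian Mt gt Pt"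
    and "riemannian_manifold Mb gb" and "mdim Mt = mdim Mb + 1"
    and "isometric_immersion Mb gb Mt gt j" and "unit_normal Mb Mt gt j N2"
    and "riemannian_manifold M g" and "mdim Mb = mdim M + 1"
    and "isometric_immersion M g Mb gb i" and "unit_normal M Mb gb i N1"
    and "induced_structure Mb Mt gt j N2 Pt Pb u2 \<xi>2 a22"
    and "induced_structure M Mb gb i N1 Pb P u1 \<xi>1 a11"
    and "\<And>p. p \<in> points M \<Longrightarrow> tangent_normal_parts M Mb gb i p (\<xi>2 (i p)) (\<xi>2_tan p) (\<xi>2_nor p)"
    and "\<And>p. p \<in> points M \<Longrightarrow>
           a12 p = gt (j (i p)) (differential Mt j (i p) (\<xi>2_nor p)) (differential Mt j (i p) (N1 p))"
    and "\<And>p. p \<in> points M \<Longrightarrow> a21 p = a12 p"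
  shows "(\<forall>X\<in>vector_fields M. \<forall>p\<in>points M.
           tangent_normal_parts M Mt gt (j \<circ> i) p
             (Pt (j (i p)) (differential Mt (j \<circ> i) p (X p)))
             (P p (X p))
             (u1 p (X p) *\<^sub>R differential Mt j (i p) (N1 p)
                + u2 (i p) (differential Mb i p (X p)) *\<^sub>R N2 (i p))) \<and>
         (\<forall>p\<in>points M.
           tangent_normal_parts M Mt gt (j \<circ> i) p
             (Pt (j (i p)) (differential Mt j (i p) (N1 p)))
             (\<xi>1 p)
             (a11 p *\<^sub>R differential Mt j (i p) (N1 p) + a12 p *\<^sub>R N2 (i p))) \<and>
         (\<forall>p\<in>points M.
           tangent_normal_parts M Mt gt (j \<circ> i) p
             (Pt (j (i p)) (N2 (i p)))
             (\<xi>2_tan p)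
             (a12 p *\<^sub>R differential Mt j (i p) (N1 p) + a22 (i p) *\<^sub>R N2 (i p)))"
proof -
  have Mt: "smooth_manifold Mt" and gt: "riemannian_metric Mt gt" and Pt: "tensor_field_11 Mt Pt"
    and Pt_Pt: "\<And>q v. q \<in> points Mt \<Longrightarrow> v \<in> tangent_space Mt q \<Longrightarrow> Pt q (Pt q v) = v"
    and Pt_iso: "\<And>q v w. q \<in> points Mt \<Longrightarrow> v \<in> tangent_space Mt q \<Longrightarrow> w \<in> tangent_space Mt q \<Longrightarrow>
      gt q (Pt q v) (Pt q w) = gt q v w"
    using assms(1) by (simp_all add: almost_product_riemannian_def riemannian_manifold_def)
  have Mb: "smooth_manifold Mb" and gb: "riemannian_metric Mb gb" and M: "smooth_manifold M"
    using assms(2,6) by (simp_all add: riemannian_manifold_def)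
  have j: "smooth_map Mb Mt j" and i: "smooth_map M Mb i" and imm: "immersion M Mb i"
    using assms(4,8) by (simp_all add: isometric_immersion_def immersion_def)

  have main: "tangent_normal_parts M Mt gt (j \<circ> i) p (Pt (j (i p)) (differential Mt (j \<circ> i) p v)) (P p v)
        (u1 p v *\<^sub>R differential Mt j (i p) (N1 p) + u2 (i p) (differential Mb i p v) *\<^sub>R N2 (i p))"
    (is "?tangential v")
    "tangent_normal_parts M Mt gt (j \<circ> i) p (Pt (j (i p)) (differential Mt j (i p) (N1 p))) (\<xi>1 p)
        (a11 p *\<^sub>R differential Mt j (i p) (N1 p) + a12 p *\<^sub>R N2 (i p))"
    (is ?normal1)
    "tangent_normal_parts M Mt gt (j \<circ> i) p (Pt (j (i p)) (N2 (i p))) (\<xi>2_tan p)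
        (a12 p *\<^sub>R differential Mt j (i p) (N1 p) + a22 (i p) *\<^sub>R N2 (i p))"
    (is ?normal2)
    if p: "p \<in> points M" and v: "v \<in> tangent_space M p" for p v
  proof -
    define q where "q = i p"
    define r where "r = j q"
    let ?dj = "differential Mt j q" and ?di = "differential Mb i p"
    let ?T = "tangent_space Mt r" and ?Tb = "tangent_space Mb q"
    have q: "q \<in> points Mb" and r: "r \<in> points Mt"
      using continuous_map_image_subset_topspace[of "mtop M" "mtop Mb" i]
        continuous_map_image_subset_topspace[of "mtop Mb" "mtop Mt" j] i j p
      by (auto simp: smooth_map_def q_def r_def)
    have dj: "?dj w \<in> ?T" if "w \<in> ?Tb" for w
      unfolding r_def by (rule differential_mem[OF Mb Mt j q that])
    have di: "?di w \<in> ?Tb" if "w \<in> tangent_space M p" for w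
      unfolding q_def by (rule differential_mem[OF M Mb i p that])
    have dji: "differential Mt (j \<circ> i) p w = ?dj (?di w)" for w
      using differential_compose[OF Mb Mt j] q by (simp add: q_def)
    note linear_dj = linear_add[OF linear_differential[of Mt j q]] linear_scale[OF linear_differential[of Mt j q]]

    \<comment> \<open>With these facts scalar products in \<open>Mt\<close> reduce: pairs of vectors
      tangent to \<open>Mb\<close> go to \<open>gb\<close>, and mixed pairs with \<open>N2\<close>
      vanish.\<close>
    have iso: "gt r (?dj w) (?dj w') = gb q w w'" if "w \<in> ?Tb" "w' \<in> ?Tb" for w w'
      using assms(4) q that by (simp add: isometric_immersion_def r_def)
    have N2: "N2 q \<in> ?T" "gt r (N2 q) (N2 q) = 1" and N2_dj: "\<And>w. w \<in> ?Tb \<Longrightarrow> gt r (N2 q) (?dj w) = 0"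
      using assms(5) q by (auto simp: unit_normal_def normal_space_def r_def)
    have dj_N2: "gt r (?dj w) (N2 q) = 0" if "w \<in> ?Tb" for w
      using N2_dj[OF that] riemannian_metric_sym[OF gt r N2(1) dj[OF that]] by simp
    have N1: "N1 p \<in> ?Tb" "gb q (N1 p) (N1 p) = 1"
      and N1_di: "\<And>w. w \<in> tangent_space M p \<Longrightarrow> gb q (N1 p) (?di w) = 0"
      using assms(9) p by (auto simp: unit_normal_def normal_space_def q_def)
    note T_add = subspace_add[OF subspace_tangent_space] and T_scale = subspace_scale[OF subspace_tangent_space]
    note gt_simps = riemannian_metric_add_left[OF gt r] riemannian_metric_add_right[OF gt r]
      riemannian_metric_scaleR_left[OF gt r] riemannian_metric_scaleR_right[OF gt r]

    have Pt_dj: "Pt r (?dj w) = ?dj (Pb q w) + u2 q w *\<^sub>R N2 q" and Pb: "Pb q w \<in> ?Tb" if "w \<in> ?Tb" for w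
      using assms(10) q that by (auto simp: induced_structure_def tangent_normal_parts_def r_def)
    have Pt_N2: "Pt r (N2 q) = ?dj (\<xi>2 q) + a22 q *\<^sub>R N2 q" and \<xi>2: "\<xi>2 q \<in> ?Tb"
      using assms(10) q by (auto simp: induced_structure_def tangent_normal_parts_def r_def)
    have Pb_di: "Pb q (?di v) = ?di (P p v) + u1 p v *\<^sub>R N1 p" and P: "P p v \<in> tangent_space M p"
      using assms(11) p v by (auto simp: induced_structure_def tangent_normal_parts_def q_def)
    have Pb_N1: "Pb q (N1 p) = ?di (\<xi>1 p) + a11 p *\<^sub>R N1 p" and \<xi>1: "\<xi>1 p \<in> tangent_space M p"
      using assms(11) p by (auto simp: induced_structure_def tangent_normal_parts_def q_def)
    have \<xi>2_eq: "\<xi>2 q = ?di (\<xi>2_tan p) + \<xi>2_nor p" and \<xi>2_tan: "\<xi>2_tan p \<in> tangent_space M p"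
      and \<xi>2_nor: "\<xi>2_nor p \<in> normal_space M Mb gb i p" "\<xi>2_nor p \<in> ?Tb"
      using assms(12)[OF p] by (auto simp: tangent_normal_parts_def normal_space_def q_def)

    \<comment> \<open>\<open>a12\<close> is given by a scalar product in \<open>Mt\<close>; the
      isometry \<open>j\<close> moves it to \<open>Mb\<close>, where \<open>N1\<close> is the unit
      normal of \<open>M\<close>.\<close>
    have a12: "a12 p = gb q (\<xi>2_nor p) (N1 p)"
      using assms(13)[OF p] iso[OF \<xi>2_nor(2) N1(1)] by (simp add: q_def r_def)
    have \<xi>2_nor_eq: "\<xi>2_nor p = a12 p *\<^sub>R N1 p"
      using hypersurface_normal_space[OF M Mb gb imm assms(7,9) p \<xi>2_nor(1)] by (simp add: a12 q_def)

    have "u2 q (N1 p) = gt r (Pt r (?dj (N1 p))) (N2 q)"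
      unfolding Pt_dj[OF N1(1)] by (simp add: gt_simps dj Pb N1 N2 dj_N2 T_scale)
    \<comment> \<open>\<open>Pt_iso\<close> is used from right to left, to bring in a second
      \<open>Pt\<close> that \<open>Pt_Pt\<close> cancels.\<close>
    also have "\<dots> = gt r (Pt r (Pt r (?dj (N1 p)))) (Pt r (N2 q))"
      using Pt_iso[OF r _ N2(1)] Pt_dj[OF N1(1)] dj[OF Pb[OF N1(1)]] N2(1) by (simp add: T_add T_scale)
    also have "\<dots> = gt r (?dj (N1 p)) (?dj (\<xi>2 q) + a22 q *\<^sub>R N2 q)"
      using Pt_Pt[OF r dj[OF N1(1)]] by (simp add: Pt_N2)
    also have "\<dots> = gb q (N1 p) (\<xi>2 q)"
      by (simp add: gt_simps dj \<xi>2 N1 N2 dj_N2 iso T_scale)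
    also have "\<dots> = gb q (N1 p) (\<xi>2_nor p)"
      by (simp add: \<xi>2_eq riemannian_metric_add_right[OF gb q] N1 di \<xi>2_tan \<xi>2_nor(2) N1_di)
    also have "\<dots> = a12 p"
      using riemannian_metric_sym[OF gb q N1(1) \<xi>2_nor(2)] by (simp add: a12)
    finally have u2_N1: "u2 q (N1 p) = a12 p" .

    \<comment> \<open>The image of \<open>N1\<close> is orthogonal to \<open>M\<close> because
      \<open>j\<close> is isometric, and \<open>N2\<close> because vectors tangent to
      \<open>M\<close> are tangent to \<open>Mb\<close>. Arbitrary coefficients let one statement
      serve all three conclusions.\<close>
    have normal: "x *\<^sub>R ?dj (N1 p) + y *\<^sub>R N2 q \<in> normal_space M Mt gt (j \<circ> i) p" for x y
      unfolding normal_space_def dji comp_apply q_def[symmetric] r_def[symmetric]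
    proof (intro CollectI conjI ballI)
      show "x *\<^sub>R ?dj (N1 p) + y *\<^sub>R N2 q \<in> ?T"
        by (intro T_add T_scale dj N1 N2)
      fix w assume "w \<in> tangent_space M p"
      then show "gt r (x *\<^sub>R ?dj (N1 p) + y *\<^sub>R N2 q) (?dj (?di w)) = 0"
        by (simp add: gt_simps dj di N1 N2 T_scale iso N1_di N2_dj)
    qed

    have "Pt r (?dj (?di v)) = ?dj (?di (P p v)) + (u1 p v *\<^sub>R ?dj (N1 p) + u2 q (?di v) *\<^sub>R N2 q)"
      by (simp add: Pt_dj[OF di[OF v]] Pb_di linear_dj add.assoc)
    then show "?tangential v"
      unfolding tangent_normal_parts_def dji q_def[symmetric] r_def[symmetric] using P normal by blast
    have "Pt r (?dj (N1 p)) = ?dj (?di (\<xi>1 p)) + (a11 p *\<^sub>R ?dj (N1 p) + a12 p *\<^sub>R N2 q)"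
      by (simp add: Pt_dj[OF N1(1)] Pb_N1 linear_dj u2_N1 add.assoc)
    then show ?normal1
      unfolding tangent_normal_parts_def dji q_def[symmetric] r_def[symmetric] using \<xi>1 normal by blast
    have "Pt r (N2 q) = ?dj (?di (\<xi>2_tan p)) + (a12 p *\<^sub>R ?dj (N1 p) + a22 q *\<^sub>R N2 q)"
      by (simp add: Pt_N2 \<xi>2_eq \<xi>2_nor_eq linear_dj add.assoc)
    then show ?normal2
      unfolding tangent_normal_parts_def dji q_def[symmetric] r_def[symmetric] using \<xi>2_tan normal by blast
  qed
  \<comment> \<open>\<open>main\<close> fixes a vector \<open>v\<close> for its first part; the
    other two do not mention it, and the zero vector fills the slot.\<close>
  have zero: "0 \<in> tangent_space M p" for p
    by (rule subspace_0[OF subspace_tangent_space])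
  have X: "X p \<in> tangent_space M p" if "X \<in> vector_fields M" "p \<in> points M" for X p
    using that by (simp add: vector_fields_def vector_field_along_def)
  show ?thesis
    using main(1)[OF _ X] main(2,3)[OF _ zero] by blast
qed

end
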